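(* Let $d\ge 1$ and let $\gamma$ be the standard Gaussian measure on $\mathbb{R}^d$. The following two statements are equivalent. (i) (Sharp symmetrized Talagrand inequality) For every centered probability measure $\mu$ on $\mathbb{R}^d$ and every probability measure $\nu$ on $\mathbb{R}^d$, $$W_2(\mu,\nu)^2\le 2\operatorname{Ent}_\gamma(\mu)+2\operatorname{Ent}_\gamma(\nu).$$ (ii) (Functional Santaló inequality) For all measurable functions $f,g$ on $\mathbb{R}^d$ satisfying $f(x)+g(y)\le -x\cdot y$ for all $x,y\in\mathbb{R}^d$ and such that $e^f$ (or $e^g$) has its barycenter at zero, $$\left(\int_{\mathbb{R}^d} e^{f}\,dx\right)\left(\int_{\mathbb{R}^d} e^{g}\,dx\right)\le (2\pi)^d.$$
   Context: A probability measure $\mu$ on $\mathbb{R}^d$ is centered if $\int |x|\,d\mu<\infty$ and $\int x\,d\mu=0$. The standard Gaussian measure $\gamma$ has density $(2\pi)^{-d/2}e^{-|x|^2/2}$ with respect to Lebesgue measure. The relative entropy is $\operatorname{Ent}_\gamma(\nu)=\int \log\frac{d\nu}{d\gamma}\,d\nu$ if $\nu\ll\gamma$, and $+\infty$ otherwise. $W_2(\mu,\nu)^2=\inf_\pi\int |x-y|^2\,d\pi(x,y)\in[0,+\infty]$, the infimum running over all couplings $\pi$ of $\mu$ and $\nu$. The function $e^f$ has its barycenter at zero if $\int |x|e^{f(x)}\,dx<\infty$ and $\int x e^{f(x)}\,dx=0$. *)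

theory Defs
  imports "HOL-Probability.Probability"
begin

text \<open>The space \<open>\<real>\<^sup>d\<close> is an arbitrary type of class \<open>euclidean_space\<close>, with
  \<open>d = DIM('a)\<close>; the class guarantees \<open>d \<ge> 1\<close>.\<close>

definition borel_prob :: "'a::euclidean_space measure \<Rightarrow> bool" where
  "borel_prob \<mu> \<longleftrightarrow> prob_space \<mu> \<and> sets \<mu> = sets borel"

definition centered :: "'a::euclidean_space measure \<Rightarrow> bool" where
  "centered \<mu> \<longleftrightarrow> integrable \<mu> (\<lambda>x. norm x) \<and> (\<integral>x. x \<partial>\<mu>) = 0"

definition std_gaussian :: "'a::euclidean_space measure" where
  "std_gaussian = density lborel
     (\<lambda>x. ennreal ((2 * pi) powr (- real DIM('a) / 2) * exp (- (norm x)\<^sup>2 / 2)))"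

text \<open>The integral of a real function with values in \<open>[-\<infinity>, \<infinity>]\<close>: positive part minus negative
  part (\<open>ennreal\<close> sends negative reals to \<open>0\<close>). The Bochner integral, and hence
  \<open>KL_divergence\<close>, would return \<open>0\<close> instead of \<open>\<infinity>\<close> when only the positive part diverges.\<close>

definition ext_integral :: "'a measure \<Rightarrow> ('a \<Rightarrow> real) \<Rightarrow> ereal" where
  "ext_integral M h =
     enn2ereal (\<integral>\<^sup>+x. ennreal (h x) \<partial>M) - enn2ereal (\<integral>\<^sup>+x. ennreal (- h x) \<partial>M)"

text \<open>For probability measures \<open>\<nu> \<lless> \<gamma>\<close> the negative part of \<open>ln (d\<nu>/d\<gamma>)\<close> is always
  \<open>\<nu>\<close>-integrable, so the case \<open>\<infinity> - \<infinity>\<close> does not occur; the density is positive and finite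
  \<open>\<nu>\<close>-almost everywhere, so the conventions for \<open>ln 0\<close> and \<open>enn2real \<infinity>\<close> are immaterial.\<close>

definition rel_entropy :: "'a measure \<Rightarrow> 'a measure \<Rightarrow> ereal" where
  "rel_entropy \<gamma> \<nu> =
     (if absolutely_continuous \<gamma> \<nu>
      then ext_integral \<nu> (\<lambda>x. ln (enn2real (RN_deriv \<gamma> \<nu> x)))
      else \<infinity>)"

definition couplings ::
    "'a::euclidean_space measure \<Rightarrow> 'a measure \<Rightarrow> ('a \<times> 'a) measure set" where
  "couplings \<mu> \<nu> = {\<pi>. prob_space \<pi> \<and> sets \<pi> = sets (borel \<Otimes>\<^sub>M borel) \<and>
     distr \<pi> borel fst = \<mu> \<and> distr \<pi> borel snd = \<nu>}"

text \<open>The squared Wasserstein distance \<open>W\<^sub>2(\<mu>, \<nu>)\<^sup>2\<close>.\<close>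

definition W2_squared :: "'a::euclidean_space measure \<Rightarrow> 'a measure \<Rightarrow> ennreal" where
  "W2_squared \<mu> \<nu> =
     (INF \<pi>\<in>couplings \<mu> \<nu>. \<integral>\<^sup>+z. ennreal ((norm (fst z - snd z))\<^sup>2) \<partial>\<pi>)"

definition barycenter_zero :: "('a::euclidean_space \<Rightarrow> real) \<Rightarrow> bool" where
  "barycenter_zero h \<longleftrightarrow>
     integrable lebesgue (\<lambda>x. norm x * h x) \<and> (\<integral>x. h x *\<^sub>R x \<partial>lebesgue) = 0"

end

theory Submission
  imports Defs
begin

text \<open>
  Kantorovich duality identifies \<open>W2_squared / 2\<close> with the supremum of
  \<open>\<integral>\<phi> d\<mu> + \<integral>\<psi> d\<nu>\<close> over \<open>\<phi> x + \<psi> y \<le> |x - y|\<^sup>2 / 2\<close>, and \<open>\<phi> = |x|\<^sup>2 / 2 + f\<close>,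
  \<open>\<psi> = |y|\<^sup>2 / 2 + g\<close> turns this constraint into \<open>f x + g y \<le> - x \<bullet> y\<close>.

  Talagrand implies Santalo: apply it to the normalised measures \<open>e\<^sup>f dx\<close> and \<open>e\<^sup>g dx\<close> and use
  the easy half of duality.

  Santalo implies Talagrand: since \<open>\<mu>\<close> is centered, adding a linear function to \<open>f\<close> (and
  translating \<open>g\<close>) does not change the dual value, so one may tilt \<open>f\<close> until \<open>e\<^sup>f\<close> has its
  barycenter at zero. Santalo and the Gibbs variational principle then bound every dual value by
  the sum of the entropies. The hard half of duality is needed only as an inequality for
  the infimum; it follows from Farkas' lemma for a finite partition into small cells and one tail
  cell, the discrete plan being spread over the cells proportionally to \<open>\<mu> \<Otimes>\<^sub>M \<nu>\<close>.\<close>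

text \<open>The obstacle in passing from Santalo to Talagrand is that an admissible dual pair
  carries no centering, whereas Santalo demands it. Tilting is free because linear functions have
  mean zero under \<mu>, so it is enough that one of the two measures is centered. The identity x .
  (y - a) = x . y - a . x turns the tilt of f into a translation of g, invisible to Lebesgue
  measure. Restricting duality to bounded potentials lets the Gaussian weight dominate every tilt,
  which makes the tilted integral finite and its minimiser exist. Finite entropy does a second job:
  it forces finite second moments, and these make the tail cell cheap. In the other direction f and
  g are real at every point, which forces fast decay, so the normalising constants and the entropies
  are finite. Their Borel representatives satisfy the constraint only off null sets, and the easy
  half of duality has to tolerate this. No constant is lost: each function contributes one factor (2
  * pi) powr (d / 2), the normalisation of \<gamma>, and their product is the Santalo bound.\<close>

subsection \<open>Finite transport duality\<close>

text \<open>Bartl's algebraic argument: if dropping the row \<open>m\<close> loses the implication, a witness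
  \<open>x0\<close> of the failure lets one project along \<open>x0\<close> onto the kernel of that row.\<close>

lemma farkas:
  fixes a :: "'i \<Rightarrow> 'k \<Rightarrow> real"
  assumes "finite I"
    and "\<And>x. (\<And>i. i \<in> I \<Longrightarrow> (\<Sum>k\<in>K. a i k * x k) \<le> 0) \<Longrightarrow> (\<Sum>k\<in>K. b k * x k) \<le> 0"
    and "finite K"
  shows "\<exists>l. (\<forall>i\<in>I. 0 \<le> l i) \<and> (\<forall>k\<in>K. b k = (\<Sum>i\<in>I. l i * a i k))"
  using assms(1,2)
proof (induction I arbitrary: a b rule: finite_induct)
  case empty
  \<comment> \<open>Without rows every vector is admissible, so \<open>b\<close> can be tested
    against itself.\<close>
  have "(\<Sum>k\<in>K. b k * b k) \<le> 0" using empty by simp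
  then have "\<forall>k\<in>K. b k * b k = 0"
    using sum_nonneg_eq_0_iff[OF \<open>finite K\<close>, of "\<lambda>k. b k * b k"]
      sum_nonneg[of K "\<lambda>k. b k * b k"] by simp
  then show ?case by simp
next
  case (insert m I)
  show ?case
  proof (cases "\<forall>x. (\<forall>i\<in>I. (\<Sum>k\<in>K. a i k * x k) \<le> 0) \<longrightarrow> (\<Sum>k\<in>K. b k * x k) \<le> 0")
    case True
    then obtain l where l: "\<forall>i\<in>I. 0 \<le> l i" "\<forall>k\<in>K. b k = (\<Sum>i\<in>I. l i * a i k)"
      using insert.IH[of a b] by blast
    have "(\<Sum>i\<in>insert m I. (l(m := 0)) i * a i k) = (\<Sum>i\<in>I. l i * a i k)" for k
      using insert.hyps by (auto intro!: sum.cong)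
    with l show ?thesis by (intro exI[of _ "l(m := 0)"]) auto
  next
    case False
    then obtain x0 where x0: "\<forall>i\<in>I. (\<Sum>k\<in>K. a i k * x0 k) \<le> 0" "0 < (\<Sum>k\<in>K. b k * x0 k)"
      by (auto simp: not_le)
    define s where "s = (\<Sum>k\<in>K. a m k * x0 k)"
    have s: "0 < s"
    proof (rule ccontr)
      assume "\<not> 0 < s"
      then have "(\<Sum>k\<in>K. b k * x0 k) \<le> 0"
        using x0(1) by (intro insert.prems) (auto simp: s_def)
      with x0(2) show False by simp
    qed
    define al where "al i = (\<Sum>k\<in>K. a i k * x0 k) / s" for i
    define be where "be = (\<Sum>k\<in>K. b k * x0 k) / s"
    define a' where "a' i k = a i k - al i * a m k" for i k
    define b' where "b' k = b k - be * a m k" for k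
    \<comment> \<open>Projecting a row and projecting the vector are adjoint operations. The
      projected vector is annihilated by row \<open>m\<close>, so bounds for the projected rows
      become bounds for the original rows at an admissible point.\<close>
    have shift: "(\<Sum>k\<in>K. (c k - ((\<Sum>k\<in>K. c k * x0 k) / s) * a m k) * x k)
        = (\<Sum>k\<in>K. c k * (x k - ((\<Sum>k\<in>K. a m k * x k) / s) * x0 k))" for c x
    proof -
      have 1: "(\<Sum>k\<in>K. (c k - C * a m k) * x k) = (\<Sum>k\<in>K. c k * x k) - C * (\<Sum>k\<in>K. a m k * x k)"
        for C by (simp add: left_diff_distrib sum_subtractf sum_distrib_left mult.assoc)
      have 2: "(\<Sum>k\<in>K. c k * (x k - D * x0 k)) = (\<Sum>k\<in>K. c k * x k) - D * (\<Sum>k\<in>K. c k * x0 k)"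
        for D by (simp add: right_diff_distrib sum_subtractf sum_distrib_left mult.left_commute)
      show ?thesis unfolding 1 2 by simp
    qed
    have "(\<Sum>k\<in>K. b' k * x k) \<le> 0" if x: "\<And>i. i \<in> I \<Longrightarrow> (\<Sum>k\<in>K. a' i k * x k) \<le> 0" for x
    proof -
      define y where "y k = x k - ((\<Sum>k\<in>K. a m k * x k) / s) * x0 k" for k
      have "(\<Sum>k\<in>K. a m k * y k) = 0"
        using s shift[of "a m" x] unfolding y_def[symmetric] s_def[symmetric] by simp
      moreover have "(\<Sum>k\<in>K. a i k * y k) \<le> 0" if "i \<in> I" for i
        using x[OF that] unfolding a'_def al_def shift y_def .
      ultimately have "(\<Sum>k\<in>K. b k * y k) \<le> 0" by (intro insert.prems) auto
      then show ?thesis unfolding b'_def be_def shift y_def .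
    qed
    from insert.IH[of a' b', OF this]
    obtain l where l: "\<forall>i\<in>I. 0 \<le> l i" "\<forall>k\<in>K. b' k = (\<Sum>i\<in>I. l i * a' i k)"
      by blast
    \<comment> \<open>Undoing the projection leaves this multiple of row \<open>m\<close>. It is
      nonnegative because \<open>x0\<close> satisfies the rows of \<open>I\<close> (so
      \<open>al i \<le> 0\<close>) and violates the conclusion (so \<open>be > 0\<close>).\<close>
    define lm where "lm = be - (\<Sum>i\<in>I. l i * al i)"
    have "(\<Sum>i\<in>I. l i * al i) \<le> 0"
      using l x0 s by (intro sum_nonpos) (auto simp: al_def mult_le_0_iff divide_le_0_iff)
    moreover have "0 < be" using x0 s by (simp add: be_def)
    ultimately have "0 \<le> lm" by (simp add: lm_def)
    moreover have "b k = (\<Sum>i\<in>insert m I. (l(m := lm)) i * a i k)" if "k \<in> K" for k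
    proof -
      have "(\<Sum>i\<in>I. (l(m := lm)) i * a i k) = (\<Sum>i\<in>I. l i * a i k)"
        using insert.hyps by (auto intro!: sum.cong)
      moreover have "b k = (\<Sum>i\<in>I. l i * a' i k) + be * a m k"
        using l that by (simp add: b'_def algebra_simps)
      moreover have "(\<Sum>i\<in>I. l i * a' i k) = (\<Sum>i\<in>I. l i * a i k) - (\<Sum>i\<in>I. l i * al i) * a m k"
        by (simp add: a'_def algebra_simps sum_subtractf sum_distrib_left)
      ultimately show ?thesis using insert.hyps by (simp add: lm_def algebra_simps)
    qed
    ultimately show ?thesis using l by (intro exI[of _ "l(m := lm)"]) auto
  qed
qed

text \<open>The Farkas multipliers of the rows \<open>(i, j)\<close> are the plan: comparing
  coefficients at the coordinates of \<open>u\<close> and \<open>v\<close> yields the marginals, and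
  at the homogenising coordinate the bound on the cost.\<close>

lemma finite_transport_duality:
  fixes c :: "'a \<Rightarrow> 'b \<Rightarrow> real"
  assumes fin: "finite A" "finite B"
    and p: "\<And>i. i \<in> A \<Longrightarrow> 0 \<le> p i" "(\<Sum>i\<in>A. p i) = 1"
    and q: "\<And>j. j \<in> B \<Longrightarrow> 0 \<le> q j" "(\<Sum>j\<in>B. q j) = 1"
    and dual: "\<And>u v. (\<And>i j. i \<in> A \<Longrightarrow> j \<in> B \<Longrightarrow> u i + v j \<le> c i j) \<Longrightarrow>
        (\<Sum>i\<in>A. p i * u i) + (\<Sum>j\<in>B. q j * v j) \<le> V"
  obtains w where "\<And>i j. i \<in> A \<Longrightarrow> j \<in> B \<Longrightarrow> 0 \<le> w i j"
    "\<And>i. i \<in> A \<Longrightarrow> (\<Sum>j\<in>B. w i j) = p i"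
    "\<And>j. j \<in> B \<Longrightarrow> (\<Sum>i\<in>A. w i j) = q j"
    "(\<Sum>i\<in>A. \<Sum>j\<in>B. w i j * c i j) \<le> V"
proof -
  \<comment> \<open>The coordinate \<open>None\<close> homogenises the constraints \<open>u i + v j \<le> c i j\<close>;
    the row \<open>None\<close> keeps it nonnegative.\<close>
  define K where "K = insert None (Some ` (A <+> B))"
  define I where "I = insert None (Some ` (A \<times> B))"
  define row :: "'a \<Rightarrow> 'b \<Rightarrow> ('a + 'b) option \<Rightarrow> real" where
    "row i j k = (case k of None \<Rightarrow> - c i j | Some (Inl i') \<Rightarrow> of_bool (i' = i)
       | Some (Inr j') \<Rightarrow> of_bool (j' = j))" for i j k
  define a where
    "a r k = (case r of None \<Rightarrow> - of_bool (k = None) | Some (i, j) \<Rightarrow> row i j k)" for r k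
  define b where
    "b k = (case k of None \<Rightarrow> - V | Some (Inl i) \<Rightarrow> p i | Some (Inr j) \<Rightarrow> q j)" for k
  have sumK: "(\<Sum>k\<in>K. f k) = f None + (\<Sum>i\<in>A. f (Some (Inl i))) + (\<Sum>j\<in>B. f (Some (Inr j)))"
    for f :: "_ \<Rightarrow> real"
    using fin unfolding K_def by (simp add: sum.reindex sum.Plus)
  have sumI: "(\<Sum>r\<in>I. f r) = f None + (\<Sum>i\<in>A. \<Sum>j\<in>B. f (Some (i, j)))" for f :: "_ \<Rightarrow> real"
    using fin unfolding I_def by (simp add: sum.reindex sum.cartesian_product split_def)
  have "(\<Sum>k\<in>K. b k * x k) \<le> 0" if x: "\<And>r. r \<in> I \<Longrightarrow> (\<Sum>k\<in>K. a r k * x k) \<le> 0" for x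
  proof -
    define t where "t = x None"
    define u where "u i = x (Some (Inl i))" for i
    define v where "v j = x (Some (Inr j))" for j
    have t: "0 \<le> t"
      using x[of None] by (simp add: I_def sumK a_def t_def)
    have uv: "u i + v j \<le> c i j * t" if "i \<in> A" "j \<in> B" for i j
      using x[of "Some (i, j)"] that fin
      by (simp add: I_def sumK a_def row_def u_def v_def t_def of_bool_def if_distrib
          if_distribR sum.delta cong: if_cong)
    have "(\<Sum>i\<in>A. p i * u i) + (\<Sum>j\<in>B. q j * v j) \<le> V * t"
    proof (cases "t = 0")
      case True
      \<comment> \<open>For \<open>t = 0\<close> the constraint reads
        \<open>u i + v j \<le> 0\<close>. Since both weights have total mass 1, the dual value is
        the average of \<open>u i + v j\<close> against \<open>p i * q j\<close>.\<close>
      have "(\<Sum>i\<in>A. p i * u i) + (\<Sum>j\<in>B. q j * v j)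
          = (\<Sum>i\<in>A. p i * u i) * (\<Sum>j\<in>B. q j) + (\<Sum>i\<in>A. p i) * (\<Sum>j\<in>B. q j * v j)"
        by (simp add: p q)
      also have "\<dots> = (\<Sum>i\<in>A. \<Sum>j\<in>B. p i * q j * (u i + v j))"
        unfolding sum_product sum.distrib[symmetric]
        by (intro sum.cong refl) (simp add: algebra_simps)
      also have "\<dots> \<le> 0"
        using uv True p q by (intro sum_nonpos) (simp add: mult_nonneg_nonpos)
      finally show ?thesis using True by simp
    next
      case False
      with t have t: "0 < t" by simp
      have "(\<Sum>i\<in>A. p i * (u i / t)) + (\<Sum>j\<in>B. q j * (v j / t)) \<le> V"
        using uv t by (intro dual) (simp add: add_divide_distrib[symmetric] pos_divide_le_eq)
      then have "((\<Sum>i\<in>A. p i * u i) + (\<Sum>j\<in>B. q j * v j)) / t \<le> V"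
        by (simp add: sum_divide_distrib add_divide_distrib)
      then show ?thesis using t by (simp add: pos_divide_le_eq)
    qed
    then show ?thesis by (simp add: sumK b_def u_def v_def t_def)
  qed
  then obtain l where l: "\<forall>r\<in>I. 0 \<le> l r" "\<forall>k\<in>K. b k = (\<Sum>r\<in>I. l r * a r k)"
    using farkas[where I = I and K = K and a = a and b = b] fin by (auto simp: I_def K_def)
  define w where "w i j = l (Some (i, j))" for i j
  show thesis
  proof
    show "0 \<le> w i j" if "i \<in> A" "j \<in> B" for i j using l that by (auto simp: I_def w_def)
    show "(\<Sum>j\<in>B. w i j) = p i" if "i \<in> A" for i
    proof -
      have "Some (Inl i) \<in> K" using that by (auto simp: K_def)
      from l(2)[rule_format, OF this] that fin show ?thesis
      by (simp add: sumI a_def b_def row_def w_def sum.swap[of _ B A] of_bool_def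
          if_distrib sum.delta cong: if_cong)
    qed
    show "(\<Sum>i\<in>A. w i j) = q j" if "j \<in> B" for j
    proof -
      have "Some (Inr j) \<in> K" using that by (auto simp: K_def)
      from l(2)[rule_format, OF this] that fin show ?thesis
      by (simp add: sumI a_def b_def row_def w_def of_bool_def
          if_distrib sum.delta cong: if_cong)
    qed
    \<comment> \<open>The nonnegative multiplier \<open>l None\<close> is the slack between the cost
      of the plan and \<open>V\<close>.\<close>
    have "- V = - l None - (\<Sum>i\<in>A. \<Sum>j\<in>B. w i j * c i j)"
      using l(2)[rule_format, of None] 
      by (simp add: K_def sumI a_def b_def row_def w_def sum_negf)
    then show "(\<Sum>i\<in>A. \<Sum>j\<in>B. w i j * c i j) \<le> V"
      using l(1) by (auto simp: I_def)
  qed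
qed

subsection \<open>Kantorovich duality for the quadratic cost\<close>

lemma nn_integral_finite_label:
  fixes T :: "'a \<Rightarrow> nat" and G :: "nat \<Rightarrow> ennreal"
  assumes [measurable]: "T \<in> M \<rightarrow>\<^sub>M count_space UNIV" and "\<And>x. T x \<le> n"
  shows "(\<integral>\<^sup>+x. G (T x) \<partial>M) = (\<Sum>i\<le>n. G i * emeasure M {x \<in> space M. T x = i})"
proof -
  have "(\<integral>\<^sup>+x. G (T x) \<partial>M) = (\<integral>\<^sup>+x. (\<Sum>i\<le>n. G i * indicator {x \<in> space M. T x = i} x) \<partial>M)"
    using assms(2) by (intro nn_integral_cong) (simp add: indicator_def if_distrib cong: if_cong)
  also have "\<dots> = (\<Sum>i\<le>n. G i * emeasure M {x \<in> space M. T x = i})"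
    by (subst nn_integral_sum) (simp_all add: nn_integral_cmult_indicator)
  finally show ?thesis .
qed

lemma integral_finite_label:
  fixes T :: "'a \<Rightarrow> nat" and u :: "nat \<Rightarrow> real"
  assumes "finite_measure M" and [measurable]: "T \<in> M \<rightarrow>\<^sub>M count_space UNIV" and "\<And>x. T x \<le> n"
  shows "(\<integral>x. u (T x) \<partial>M) = (\<Sum>i\<le>n. measure M {x \<in> space M. T x = i} * u i)"
proof -
  interpret finite_measure M by fact
  have "(\<integral>x. u (T x) \<partial>M) = (\<integral>x. (\<Sum>i\<le>n. indicator {x \<in> space M. T x = i} x * u i) \<partial>M)"
    using assms(3) by (intro Bochner_Integration.integral_cong)
      (simp_all add: indicator_def if_distrib if_distribR cong: if_cong)
  also have "\<dots> = (\<Sum>i\<le>n. measure M {x \<in> space M. T x = i} * u i)"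
    by (subst Bochner_Integration.integral_sum) (auto simp: emeasure_finite less_top[symmetric])
  finally show ?thesis .
qed

text \<open>On each product of cells the coupling is proportional to \<open>\<mu> \<Otimes>\<^sub>M \<nu>\<close>, so no optimal
  plan, and hence no compactness of the set of couplings, is needed.\<close>

lemma coupling_from_finite_plan:
  fixes \<mu> \<nu> :: "'a::euclidean_space measure" and T :: "'a \<Rightarrow> nat"
  assumes \<mu>: "borel_prob \<mu>" and \<nu>: "borel_prob \<nu>"
    and T[measurable]: "T \<in> borel \<rightarrow>\<^sub>M count_space UNIV" and Tn: "\<And>x. T x \<le> n"
    and w0: "\<And>i j. i \<le> n \<Longrightarrow> j \<le> n \<Longrightarrow> 0 \<le> w i j"
    and wp: "\<And>i. i \<le> n \<Longrightarrow> (\<Sum>j\<le>n. w i j) = measure \<mu> {x. T x = i}"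
    and wq: "\<And>j. j \<le> n \<Longrightarrow> (\<Sum>i\<le>n. w i j) = measure \<nu> {x. T x = j}"
  shows "\<exists>\<pi>\<in>couplings \<mu> \<nu>. \<forall>c. (\<forall>i j. 0 \<le> c i j) \<longrightarrow>
    (\<integral>\<^sup>+z. ennreal (c (T (fst z)) (T (snd z))) \<partial>\<pi>) = ennreal (\<Sum>i\<le>n. \<Sum>j\<le>n. w i j * c i j)"
proof -
  interpret M: prob_space \<mu> using \<mu> by (simp add: borel_prob_def)
  interpret N: prob_space \<nu> using \<nu> by (simp add: borel_prob_def)
  interpret P: pair_sigma_finite \<mu> \<nu> ..
  have [measurable_cong, simp]: "sets \<mu> = sets borel" "sets \<nu> = sets borel"
    using \<mu> \<nu> by (auto simp: borel_prob_def)
  have [simp]: "space \<mu> = UNIV" "space \<nu> = UNIV"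
    using sets_eq_imp_space_eq[of \<mu> borel] sets_eq_imp_space_eq[of \<nu> borel] by auto
  define p where "p i = measure \<mu> {x. T x = i}" for i
  define q where "q j = measure \<nu> {x. T x = j}" for j
  define h where "h i j = w i j / (p i * q j)" for i j
  have h0: "0 \<le> h i j" if "i \<le> n" "j \<le> n" for i j
    using w0[OF that] by (simp add: h_def p_def q_def)
  \<comment> \<open>These bounds deal with cells of mass zero: there the quotient
    \<open>h i j\<close> is 0 by convention, and \<open>w i j\<close> vanishes too, so
    \<open>hw\<close> holds without exception.\<close>
  have w_le_p: "w i j \<le> p i" and w_le_q: "w i j \<le> q j" if "i \<le> n" "j \<le> n" for i j
    using that w0 member_le_sum[of j "{..n}" "w i"] member_le_sum[of i "{..n}" "\<lambda>i. w i j"]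
      wp wq by (auto simp: p_def q_def)
  have hw: "h i j * (p i * q j) = w i j" if "i \<le> n" "j \<le> n" for i j
    using w_le_p[OF that] w_le_q[OF that] w0[OF that] by (auto simp: h_def)
  define \<pi> where "\<pi> = density (\<mu> \<Otimes>\<^sub>M \<nu>) (\<lambda>z. ennreal (h (T (fst z)) (T (snd z))))"
  have h_meas[measurable]: "(\<lambda>z. ennreal (h (T (fst z)) (T (snd z)))) \<in> borel_measurable (\<mu> \<Otimes>\<^sub>M \<nu>)"
    by measurable
  have sets_pi: "sets \<pi> = sets (borel \<Otimes>\<^sub>M borel)"
    unfolding \<pi>_def sets_density by (rule sets_pair_measure_cong) simp_all
  have row: "(\<integral>\<^sup>+y. ennreal (h i (T y)) \<partial>\<nu>) = 1" if "i \<le> n" "p i \<noteq> 0" for i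
  proof -
    have "(\<integral>\<^sup>+y. ennreal (h i (T y)) \<partial>\<nu>) = (\<Sum>j\<le>n. ennreal (h i j) * ennreal (q j))"
      by (subst nn_integral_finite_label[where n = n]) (auto simp: Tn q_def N.emeasure_eq_measure)
    also have "\<dots> = ennreal (\<Sum>j\<le>n. h i j * q j)"
      using h0 that by (subst sum_ennreal[symmetric]) (auto simp: q_def ennreal_mult)
    also have "(\<Sum>j\<le>n. h i j * q j) = (\<Sum>j\<le>n. w i j / p i)"
      using hw[OF that(1)] that(2) by (intro sum.cong) (auto simp: field_simps)
    also have "\<dots> = 1"
      using wp[OF that(1)] that(2) by (simp add: sum_divide_distrib[symmetric] p_def)
    finally show ?thesis by simp
  qed
  have col: "(\<integral>\<^sup>+x. ennreal (h (T x) j) \<partial>\<mu>) = 1" if "j \<le> n" "q j \<noteq> 0" for j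
  proof -
    have "(\<integral>\<^sup>+x. ennreal (h (T x) j) \<partial>\<mu>) = (\<Sum>i\<le>n. ennreal (h i j) * ennreal (p i))"
      by (subst nn_integral_finite_label[where n = n and G = "\<lambda>i. ennreal (h i j)"])
        (auto simp: Tn p_def M.emeasure_eq_measure)
    also have "\<dots> = ennreal (\<Sum>i\<le>n. h i j * p i)"
      using h0 that by (subst sum_ennreal[symmetric]) (auto simp: p_def ennreal_mult)
    also have "(\<Sum>i\<le>n. h i j * p i) = (\<Sum>i\<le>n. w i j / q j)"
      using hw[OF _ that(1)] that(2) by (intro sum.cong) (auto simp: field_simps)
    also have "\<dots> = 1"
      using wq[OF that(1)] that(2) by (simp add: sum_divide_distrib[symmetric] q_def)
    finally show ?thesis by simp
  qed
  \<comment> \<open>\<open>row\<close> and \<open>col\<close> give 1 only for cells of positive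
    mass. Almost every point lies in such a cell because there are finitely many cells.\<close>
  have "AE x in \<mu>. \<forall>i\<in>{..n}. p i = 0 \<longrightarrow> T x \<noteq> i"
  proof (rule AE_finite_allI, simp)
    fix i show "AE x in \<mu>. p i = 0 \<longrightarrow> T x \<noteq> i"
    proof (cases "p i = 0")
      case True
      then have "emeasure \<mu> {x. T x = i} = 0"
        by (simp add: M.emeasure_eq_measure p_def)
      then show ?thesis by (intro AE_I[where N = "{x. T x = i}"]) auto
    qed simp
  qed
  then have AEp: "AE x in \<mu>. p (T x) \<noteq> 0" using Tn by (auto elim: eventually_mono)
  have "AE x in \<nu>. \<forall>i\<in>{..n}. q i = 0 \<longrightarrow> T x \<noteq> i"
  proof (rule AE_finite_allI, simp)
    fix i show "AE x in \<nu>. q i = 0 \<longrightarrow> T x \<noteq> i"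
    proof (cases "q i = 0")
      case True
      then have "emeasure \<nu> {x. T x = i} = 0"
        by (simp add: N.emeasure_eq_measure q_def)
      then show ?thesis by (intro AE_I[where N = "{x. T x = i}"]) auto
    qed simp
  qed
  then have AEq: "AE x in \<nu>. q (T x) \<noteq> 0" using Tn by (auto elim: eventually_mono)
  have meas_pi: "measurable \<pi> N = measurable (borel \<Otimes>\<^sub>M borel) N" for N :: "'b measure"
    by (rule measurable_cong_sets[OF sets_pi refl])
  have marg1: "distr \<pi> borel fst = \<mu>"
  proof (rule measure_eqI)
    fix A assume "A \<in> sets (distr \<pi> borel fst)"
    then have [measurable]: "A \<in> sets borel" by simp
    have "emeasure (distr \<pi> borel fst) A = (\<integral>\<^sup>+z. indicator A z \<partial>distr \<pi> borel fst)"
      by simp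
    also have "\<dots> = (\<integral>\<^sup>+z. indicator A (fst z) \<partial>\<pi>)"
      by (subst nn_integral_distr) (simp_all add: meas_pi)
    also have "\<dots> = (\<integral>\<^sup>+z. ennreal (h (T (fst z)) (T (snd z))) * indicator A (fst z) \<partial>(\<mu> \<Otimes>\<^sub>M \<nu>))"
      unfolding \<pi>_def by (subst nn_integral_density) simp_all
    also have "\<dots> = (\<integral>\<^sup>+x. \<integral>\<^sup>+y. ennreal (h (T x) (T y)) * indicator A x \<partial>\<nu> \<partial>\<mu>)"
      by (subst N.nn_integral_fst[symmetric]) simp_all
    also have "\<dots> = (\<integral>\<^sup>+x. indicator A x \<partial>\<mu>)"
      using AEp by (intro nn_integral_cong_AE) (auto simp: nn_integral_multc row Tn elim!: eventually_mono)
    finally show "emeasure (distr \<pi> borel fst) A = emeasure \<mu> A" by simp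
  qed simp
  have marg2: "distr \<pi> borel snd = \<nu>"
  proof (rule measure_eqI)
    fix A assume "A \<in> sets (distr \<pi> borel snd)"
    then have [measurable]: "A \<in> sets borel" by simp
    have "emeasure (distr \<pi> borel snd) A = (\<integral>\<^sup>+z. indicator A z \<partial>distr \<pi> borel snd)"
      by simp
    also have "\<dots> = (\<integral>\<^sup>+z. indicator A (snd z) \<partial>\<pi>)"
      by (subst nn_integral_distr) (simp_all add: meas_pi)
    also have "\<dots> = (\<integral>\<^sup>+z. ennreal (h (T (fst z)) (T (snd z))) * indicator A (snd z) \<partial>(\<mu> \<Otimes>\<^sub>M \<nu>))"
      unfolding \<pi>_def by (subst nn_integral_density) simp_all
    also have "\<dots> = (\<integral>\<^sup>+y. \<integral>\<^sup>+x. ennreal (h (T x) (T y)) * indicator A y \<partial>\<mu> \<partial>\<nu>)"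
      by (subst P.nn_integral_snd[symmetric]) simp_all
    also have "\<dots> = (\<integral>\<^sup>+x. indicator A x \<partial>\<nu>)"
      using AEq by (intro nn_integral_cong_AE) (auto simp: nn_integral_multc col Tn elim!: eventually_mono)
    finally show "emeasure (distr \<pi> borel snd) A = emeasure \<nu> A" by simp
  qed simp
  have "prob_space \<pi>"
  proof
    have "emeasure \<pi> (space \<pi>) = emeasure (distr \<pi> borel fst) UNIV"
      by (subst emeasure_distr) (simp_all add: meas_pi)
    then show "emeasure \<pi> (space \<pi>) = 1" using marg1 M.emeasure_space_1 by simp
  qed
  with sets_pi marg1 marg2 have "\<pi> \<in> couplings \<mu> \<nu>" by (simp add: couplings_def)
  moreover have "(\<integral>\<^sup>+z. ennreal (c (T (fst z)) (T (snd z))) \<partial>\<pi>)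
        = ennreal (\<Sum>i\<le>n. \<Sum>j\<le>n. w i j * c i j)" if c: "\<And>i j. 0 \<le> c i j" for c
  proof -
    have "(\<integral>\<^sup>+z. ennreal (c (T (fst z)) (T (snd z))) \<partial>\<pi>)
      = (\<integral>\<^sup>+z. ennreal (h (T (fst z)) (T (snd z))) * ennreal (c (T (fst z)) (T (snd z))) \<partial>(\<mu> \<Otimes>\<^sub>M \<nu>))"
      unfolding \<pi>_def by (subst nn_integral_density) simp_all
    also have "\<dots> = (\<integral>\<^sup>+x. \<integral>\<^sup>+y. ennreal (h (T x) (T y)) * ennreal (c (T x) (T y)) \<partial>\<nu> \<partial>\<mu>)"
      by (subst N.nn_integral_fst[symmetric]) simp_all
    also have "\<dots> = (\<integral>\<^sup>+x. (\<Sum>j\<le>n. ennreal (h (T x) j) * ennreal (c (T x) j) * ennreal (q j)) \<partial>\<mu>)"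
      by (subst nn_integral_finite_label[where n = n and M = \<nu>
            and G = "\<lambda>j. ennreal (h (T x) j) * ennreal (c (T x) j)" for x])
        (simp_all add: Tn q_def N.emeasure_eq_measure)
    also have "\<dots> = (\<Sum>i\<le>n. (\<Sum>j\<le>n. ennreal (h i j) * ennreal (c i j) * ennreal (q j)) * ennreal (p i))"
      by (subst nn_integral_finite_label[where n = n
            and G = "\<lambda>i. \<Sum>j\<le>n. ennreal (h i j) * ennreal (c i j) * ennreal (q j)"])
        (simp_all add: Tn p_def M.emeasure_eq_measure)
    also have "\<dots> = (\<Sum>i\<le>n. \<Sum>j\<le>n. ennreal (w i j * c i j))"
      unfolding sum_distrib_right
    proof (intro sum.cong refl)
      fix i j assume "i \<in> {..n}" "j \<in> {..n}"
      then have ij: "i \<le> n" "j \<le> n" by auto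
      have "ennreal (h i j) * ennreal (c i j) * ennreal (q j) * ennreal (p i)
          = ennreal ((h i j * (p i * q j)) * c i j)"
        using h0[OF ij] c by (simp add: p_def q_def ennreal_mult[symmetric] mult_ac)
      then show "ennreal (h i j) * ennreal (c i j) * ennreal (q j) * ennreal (p i)
          = ennreal (w i j * c i j)" by (simp add: hw[OF ij])
    qed
    also have "\<dots> = ennreal (\<Sum>i\<le>n. \<Sum>j\<le>n. w i j * c i j)"
    proof -
      have "(\<Sum>j\<le>n. ennreal (w i j * c i j)) = ennreal (\<Sum>j\<le>n. w i j * c i j)" if "i \<le> n" for i
        using c w0[OF that] by (intro sum_ennreal) simp
      then have "(\<Sum>i\<le>n. \<Sum>j\<le>n. ennreal (w i j * c i j)) = (\<Sum>i\<le>n. ennreal (\<Sum>j\<le>n. w i j * c i j))"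
        by simp
      also have "\<dots> = ennreal (\<Sum>i\<le>n. \<Sum>j\<le>n. w i j * c i j)"
        using c w0 by (intro sum_ennreal sum_nonneg) simp
      finally show ?thesis .
    qed
    finally show ?thesis .
  qed
  ultimately show ?thesis by blast
qed

section \<open>Discretisation of space and of the quadratic cost\<close>

lemma finite_borel_labelling:
  fixes R \<delta> :: real
  assumes "0 < \<delta>"
  obtains T :: "'a::euclidean_space \<Rightarrow> nat" and n and ctr :: "nat \<Rightarrow> 'a"
  where "T \<in> borel \<rightarrow>\<^sub>M count_space UNIV" "\<And>x. T x \<le> n"
    "\<And>x. T x = 0 \<longleftrightarrow> R < norm x" "\<And>x. norm x \<le> R \<Longrightarrow> norm (x - ctr (T x)) < \<delta>"
proof -
  obtain k :: "'a set" where k: "finite k" "cball 0 R \<subseteq> (\<Union>x\<in>k. ball x \<delta>)"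
    using compact_cball[of 0 R] assms unfolding compact_eq_totally_bounded by blast
  obtain xs where xs: "set xs = k" using finite_list k(1) by blast
  \<comment> \<open>The implication holds vacuously at \<open>length xs\<close>, so a least index
    exists for every \<open>x\<close>; inside the ball a genuine net point comes earlier.\<close>
  define L where "L x = (LEAST i. i < length xs \<longrightarrow> norm (x - xs ! i) < \<delta>)" for x
  have L: "L x < length xs \<and> norm (x - xs ! L x) < \<delta>" if "norm x \<le> R" for x
  proof -
    have "x \<in> (\<Union>y\<in>k. ball y \<delta>)" using that k(2) by (intro subsetD[OF k(2)]) simp
    then obtain y where "y \<in> set xs" "norm (x - y) < \<delta>"
      using xs by (auto simp: dist_norm norm_minus_commute)
    then obtain i where i: "i < length xs" "norm (x - xs ! i) < \<delta>"
      unfolding in_set_conv_nth by blast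
    have "L x \<le> i" unfolding L_def by (rule Least_le) (use i in auto)
    moreover have "L x < length xs \<longrightarrow> norm (x - xs ! L x) < \<delta>"
      unfolding L_def by (rule LeastI) (use i in auto)
    ultimately show ?thesis using i by auto
  qed
  show thesis
  proof
    show "(\<lambda>x. if norm x \<le> R then Suc (L x) else 0) \<in> borel \<rightarrow>\<^sub>M count_space UNIV"
      unfolding L_def by measurable
    show "(if norm x \<le> R then Suc (L x) else 0) \<le> length xs" for x
      using L[of x] by auto
    \<comment> \<open>Indices are shifted by one to free label 0 for the outside of the ball, so the
      centre of label \<open>k\<close> is \<open>xs ! (k - 1)\<close>.\<close>
    show "norm (x - (xs ! ((if norm x \<le> R then Suc (L x) else 0) - 1))) < \<delta>"
      if "norm x \<le> R" for x using L[OF that] that by simp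
  qed auto
qed

lemma half_dist_sq_perturb:
  fixes x y a b :: "'a::real_inner"
  assumes "norm x \<le> R" "norm y \<le> R" "norm (x - a) \<le> \<delta>" "norm (y - b) \<le> \<delta>" "\<delta> \<le> 1"
  shows "\<bar>(norm (x - y))\<^sup>2 / 2 - (norm (a - b))\<^sup>2 / 2\<bar> \<le> \<delta> * (4 * R + 2)"
proof -
  have d: "\<bar>norm (x - y) - norm (a - b)\<bar> \<le> 2 * \<delta>"
  proof -
    have "norm ((x - y) - (a - b)) \<le> norm (x - a) + norm (y - b)"
      using norm_triangle_ineq4[of "x - a" "y - b"] by (simp add: algebra_simps)
    then show ?thesis using norm_triangle_ineq3[of "x - y" "a - b"] assms by linarith
  qed
  have xy: "norm (x - y) \<le> 2 * R" using norm_triangle_ineq4[of x y] assms by linarith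
  have "0 \<le> \<delta>" using assms(3) norm_ge_zero order_trans by blast
  have "\<bar>(norm (x - y))\<^sup>2 / 2 - (norm (a - b))\<^sup>2 / 2\<bar>
      = \<bar>norm (x - y) - norm (a - b)\<bar> * ((norm (x - y) + norm (a - b)) / 2)"
  proof -
    have "(norm (x - y))\<^sup>2 / 2 - (norm (a - b))\<^sup>2 / 2
        = (norm (x - y) - norm (a - b)) * ((norm (x - y) + norm (a - b)) / 2)"
      by (simp add: power2_eq_square algebra_simps)
    then show ?thesis by (simp only: abs_mult) simp
  qed
  \<comment> \<open>The second factor is the mean of the two distances, at most 2R and 2R +
    2\<delta>, hence at most 2R + 1.\<close>
  also have "\<dots> \<le> (2 * \<delta>) * (2 * R + 1)"
    using d xy assms \<open>0 \<le> \<delta>\<close> by (intro mult_mono) auto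
  finally show ?thesis by (simp add: algebra_simps)
qed

lemma tail_second_moment:
  fixes \<mu> :: "'a::euclidean_space measure"
  assumes "integrable \<mu> (\<lambda>x. (norm x)\<^sup>2)" "sets \<mu> = sets borel" "0 < e"
  shows "\<forall>\<^sub>F R in sequentially. (\<integral>\<^sup>+x. ennreal ((norm x)\<^sup>2 * of_bool (real R < norm x)) \<partial>\<mu>) \<le> ennreal e"
proof -
  note [measurable_cong] = assms(2)
  have "(\<lambda>R. \<integral>x. (norm x)\<^sup>2 * of_bool (real R < norm x) \<partial>\<mu>) \<longlonglongrightarrow> (\<integral>x. 0 \<partial>\<mu>)"
  proof (rule integral_dominated_convergence[OF _ _ assms(1)])
    have "(\<lambda>R. (norm x)\<^sup>2 * of_bool (real R < norm x)) \<longlonglongrightarrow> 0" for x :: 'a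
    proof (rule tendsto_eventually)
      have "\<forall>\<^sub>F R in sequentially. norm x \<le> real R"
        using filterlim_real_sequentially by (simp add: filterlim_at_top)
      then show "\<forall>\<^sub>F R in sequentially. (norm x)\<^sup>2 * of_bool (real R < norm x) = 0"
        by eventually_elim auto
    qed
    then show "AE x in \<mu>. (\<lambda>R. (norm x)\<^sup>2 * of_bool (real R < norm x)) \<longlonglongrightarrow> 0" by simp
  qed (auto simp: of_bool_def)
  then have "\<forall>\<^sub>F R in sequentially. (\<integral>x. (norm x)\<^sup>2 * of_bool (real R < norm x) \<partial>\<mu>) < e"
    using assms(3) by (auto intro: order_tendstoD)
  then show ?thesis
  proof eventually_elim
    case (elim R)
    have "integrable \<mu> (\<lambda>x. (norm x)\<^sup>2 * of_bool (real R < norm x))"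
      by (rule Bochner_Integration.integrable_bound[OF assms(1)]) (auto simp: of_bool_def)
    with elim show ?case by (subst nn_integral_eq_integral) (auto intro!: ennreal_leI)
  qed
qed

text \<open>Finite potentials \<open>u\<close>, \<open>v\<close> pull back to step functions
  \<open>u (T x)\<close>, \<open>v (T y)\<close>, so the dual bound has to be known for bounded
  Borel potentials only. Arbitrary slack \<open>e\<close> takes the place of an optimal
  plan.\<close>

proposition W2_squared_le_dual:
  fixes \<mu> \<nu> :: "'a::euclidean_space measure"
  assumes \<mu>: "borel_prob \<mu>" and \<nu>: "borel_prob \<nu>"
    and mom: "integrable \<mu> (\<lambda>x. (norm x)\<^sup>2)" "integrable \<nu> (\<lambda>x. (norm x)\<^sup>2)"
    and dual: "\<And>\<phi> \<psi> :: 'a \<Rightarrow> real. \<lbrakk>\<phi> \<in> borel_measurable borel; \<psi> \<in> borel_measurable borel;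
        bounded (range \<phi>); bounded (range \<psi>); \<And>x y. \<phi> x + \<psi> y \<le> (norm (x - y))\<^sup>2 / 2\<rbrakk>
        \<Longrightarrow> (\<integral>x. \<phi> x \<partial>\<mu>) + (\<integral>y. \<psi> y \<partial>\<nu>) \<le> V"
  shows "W2_squared \<mu> \<nu> \<le> ennreal (2 * V)"
proof (rule ennreal_le_epsilon)
  fix e :: real assume e: "0 < e"
  interpret M: prob_space \<mu> using \<mu> by (simp add: borel_prob_def)
  interpret N: prob_space \<nu> using \<nu> by (simp add: borel_prob_def)
  have sets_\<mu>: "sets \<mu> = sets borel" and sets_\<nu>: "sets \<nu> = sets borel"
    using \<mu> \<nu> by (auto simp: borel_prob_def)
  note [measurable_cong] = sets_\<mu> sets_\<nu>
  have [simp]: "space \<mu> = UNIV" "space \<nu> = UNIV"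
    using sets_eq_imp_space_eq[OF sets_\<mu>] sets_eq_imp_space_eq[OF sets_\<nu>] by auto
  define tail :: "nat \<Rightarrow> 'a \<Rightarrow> real" where
    "tail R x = (norm x)\<^sup>2 * of_bool (real R < norm x)" for R x
  have tail0: "0 \<le> tail R x" for R x by (simp add: tail_def)
  have tail_meas[measurable]: "tail R \<in> borel_measurable borel" for R
    unfolding tail_def of_bool_def by measurable
  \<comment> \<open>The final estimate has three errors, \<open>4 * \<eta>\<close> and four times
    each tail integral; \<open>e / 12\<close> for each adds up to \<open>e\<close>.\<close>
  obtain R where R: "(\<integral>\<^sup>+x. tail R x \<partial>\<mu>) \<le> ennreal (e / 12)" "(\<integral>\<^sup>+x. tail R x \<partial>\<nu>) \<le> ennreal (e / 12)"
    using eventually_conj[OF tail_second_moment[OF mom(1) sets_\<mu>, of "e / 12"]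
        tail_second_moment[OF mom(2) sets_\<nu>, of "e / 12"]] e
    unfolding tail_def eventually_sequentially by auto
  define \<delta> where "\<delta> = min 1 (e / 12 / (4 * real R + 2))"
  have \<delta>: "0 < \<delta>" "\<delta> \<le> 1" using e by (auto simp: \<delta>_def)
  define \<eta> where "\<eta> = \<delta> * (4 * real R + 2)"
  have "\<eta> \<le> e / 12"
    unfolding \<eta>_def by (subst pos_le_divide_eq[symmetric]) (auto simp: \<delta>_def)
  moreover have "0 \<le> \<eta>" using \<delta> by (simp add: \<eta>_def)
  ultimately have \<eta>: "\<eta> \<le> e / 12" "0 \<le> \<eta>" by auto
  obtain T :: "'a \<Rightarrow> nat" and n ctr where T[measurable]: "T \<in> borel \<rightarrow>\<^sub>M count_space UNIV"
    and Tn: "\<And>x. T x \<le> n" and T0: "\<And>x. T x = 0 \<longleftrightarrow> real R < norm x"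
    and ctr: "\<And>x. norm x \<le> R \<Longrightarrow> norm (x - ctr (T x)) < \<delta>"
    using finite_borel_labelling[OF \<delta>(1), of "real R"] by metis
  \<comment> \<open>Label \<open>0\<close> is the unbounded cell outside the ball of radius \<open>R\<close>; its cost is
    put to \<open>0\<close> and accounted for by the tails of the second moments.\<close>
  define c where
    "c i j = (if i = 0 \<or> j = 0 then 0 else max 0 ((norm (ctr i - ctr j))\<^sup>2 / 2 - \<eta>))" for i j
  have c0: "0 \<le> c i j" for i j by (simp add: c_def)
  have near: "\<bar>(norm (x - y))\<^sup>2 / 2 - (norm (ctr (T x) - ctr (T y)))\<^sup>2 / 2\<bar> \<le> \<eta>"
    if "norm x \<le> R" "norm y \<le> R" for x y
    unfolding \<eta>_def using that ctr[OF that(1)] ctr[OF that(2)] \<delta>(2)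
    by (intro half_dist_sq_perturb) auto
  \<comment> \<open>Potentials feasible for \<open>c\<close> must remain feasible for the true cost;
    this is why \<open>c\<close> subtracts the oscillation \<open>\<eta>\<close> within
    cells.\<close>
  have lower: "c (T x) (T y) \<le> (norm (x - y))\<^sup>2 / 2" for x y
    using near[of x y] zero_le_power2[of "norm (x - y)"] unfolding c_def abs_le_iff
    by (auto simp: T0 not_less max_def; linarith)
  \<comment> \<open>In the ball \<open>\<eta>\<close> is lost twice, by the subtraction and by the
    oscillation, and doubled because this cost is not halved. Otherwise the point of larger norm
    lies outside the ball, so its tail term controls both squares.\<close>
  have upper: "(norm (x - y))\<^sup>2 \<le> 2 * c (T x) (T y) + 4 * \<eta> + 4 * tail R x + 4 * tail R y" for x y
  proof (cases "norm x \<le> R \<and> norm y \<le> R")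
    case True
    then have "(norm (x - y))\<^sup>2 \<le> 2 * c (T x) (T y) + 4 * \<eta>"
      using near[of x y] unfolding c_def abs_le_iff by (auto simp: T0 not_less max_def; linarith)
    then show ?thesis using tail0[of R x] tail0[of R y] by linarith
  next
    case False
    have "(norm (x - y))\<^sup>2 \<le> (norm x + norm y)\<^sup>2"
      by (intro power_mono norm_triangle_ineq4) simp
    also have "\<dots> \<le> 2 * (norm x)\<^sup>2 + 2 * (norm y)\<^sup>2"
      using zero_le_power2[of "norm x - norm y"] by (simp add: power2_eq_square algebra_simps)
    also have "\<dots> \<le> 4 * tail R x + 4 * tail R y"
    proof -
      have "(norm y)\<^sup>2 \<le> (norm x)\<^sup>2" if "norm y \<le> R" "\<not> norm x \<le> R"
        using that by (intro power_mono) auto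
      moreover have "(norm x)\<^sup>2 \<le> (norm y)\<^sup>2" if "norm x \<le> R" "\<not> norm y \<le> R"
        using that by (intro power_mono) auto
      ultimately show ?thesis using False by (auto simp: tail_def)
    qed
    finally show ?thesis using \<eta>(2) c0[of "T x" "T y"] by linarith
  qed
  have prob_sum: "(\<Sum>i\<le>n. measure \<rho> {x. T x = i}) = 1"
    if "prob_space \<rho>" "sets \<rho> = sets borel" for \<rho> :: "'a measure"
  proof -
    interpret prob_space \<rho> by fact
    note [measurable_cong] = that(2)
    have "(\<integral>x. 1 \<partial>\<rho>) = (\<Sum>i\<le>n. measure \<rho> {x \<in> space \<rho>. T x = i} * 1)"
      using Tn by (intro integral_finite_label finite_measure_axioms) auto
    then show ?thesis
      using sets_eq_imp_space_eq[OF that(2)] prob_space by simp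
  qed
  have fin_bounded: "bounded (range (\<lambda>x. u (T x)))" for u :: "nat \<Rightarrow> real"
  proof (rule finite_imp_bounded, rule finite_subset)
    show "range (\<lambda>x. u (T x)) \<subseteq> u ` {..n}" using Tn by auto
  qed simp
  obtain w where w: "\<And>i j. i \<in> {..n} \<Longrightarrow> j \<in> {..n} \<Longrightarrow> 0 \<le> w i j"
    "\<And>i. i \<in> {..n} \<Longrightarrow> (\<Sum>j\<in>{..n}. w i j) = measure \<mu> {x. T x = i}"
    "\<And>j. j \<in> {..n} \<Longrightarrow> (\<Sum>i\<in>{..n}. w i j) = measure \<nu> {x. T x = j}"
    "(\<Sum>i\<in>{..n}. \<Sum>j\<in>{..n}. w i j * c i j) \<le> V"
  proof (rule finite_transport_duality[of "{..n}" "{..n}" "\<lambda>i. measure \<mu> {x. T x = i}"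
        "\<lambda>j. measure \<nu> {x. T x = j}" c V])
    fix u v :: "nat \<Rightarrow> real"
    assume uv: "\<And>i j. i \<in> {..n} \<Longrightarrow> j \<in> {..n} \<Longrightarrow> u i + v j \<le> c i j"
    have "(\<integral>x. u (T x) \<partial>\<mu>) + (\<integral>y. v (T y) \<partial>\<nu>) \<le> V"
    proof (rule dual)
      show "u (T x) + v (T y) \<le> (norm (x - y))\<^sup>2 / 2" for x y
        using uv[of "T x" "T y"] Tn lower[of x y] by simp
    qed (auto intro: fin_bounded)
    then show "(\<Sum>i\<le>n. measure \<mu> {x. T x = i} * u i) + (\<Sum>j\<le>n. measure \<nu> {x. T x = j} * v j) \<le> V"
      using integral_finite_label[OF M.finite_measure_axioms, of T n u]
        integral_finite_label[OF N.finite_measure_axioms, of T n v] Tn by simp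
  qed (use prob_sum[OF M.prob_space_axioms sets_\<mu>] prob_sum[OF N.prob_space_axioms sets_\<nu>] in auto)
  obtain \<pi> where \<pi>: "\<pi> \<in> couplings \<mu> \<nu>"
    "\<And>c. (\<And>i j. 0 \<le> c i j) \<Longrightarrow> (\<integral>\<^sup>+z. ennreal (c (T (fst z)) (T (snd z))) \<partial>\<pi>)
        = ennreal (\<Sum>i\<le>n. \<Sum>j\<le>n. w i j * c i j)"
    using coupling_from_finite_plan[OF \<mu> \<nu> T Tn w(1-3)[unfolded atMost_iff]] by blast
  have sets_\<pi>[measurable_cong]: "sets \<pi> = sets (borel \<Otimes>\<^sub>M borel)"
    and marg: "distr \<pi> borel fst = \<mu>" "distr \<pi> borel snd = \<nu>" and "prob_space \<pi>"
    using \<pi>(1) by (auto simp: couplings_def)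
  interpret P: prob_space \<pi> by fact
  have tails: "(\<integral>\<^sup>+z. tail R (fst z) \<partial>\<pi>) \<le> ennreal (e / 12)"
    "(\<integral>\<^sup>+z. tail R (snd z) \<partial>\<pi>) \<le> ennreal (e / 12)"
    using R nn_integral_distr[of fst \<pi> borel "\<lambda>x. ennreal (tail R x)"]
      nn_integral_distr[of snd \<pi> borel "\<lambda>x. ennreal (tail R x)"] by (simp_all add: marg)
  have cost: "(\<integral>\<^sup>+z. ennreal (c (T (fst z)) (T (snd z))) \<partial>\<pi>) = ennreal (\<Sum>i\<le>n. \<Sum>j\<le>n. w i j * c i j)"
    using \<pi>(2) c0 by blast
  have "W2_squared \<mu> \<nu> \<le> (\<integral>\<^sup>+z. ennreal ((norm (fst z - snd z))\<^sup>2) \<partial>\<pi>)"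
    unfolding W2_squared_def by (rule INF_lower[OF \<pi>(1)])
  also have "\<dots> \<le> (\<integral>\<^sup>+z. 2 * ennreal (c (T (fst z)) (T (snd z))) + ennreal (4 * \<eta>)
      + 4 * ennreal (tail R (fst z)) + 4 * ennreal (tail R (snd z)) \<partial>\<pi>)"
  proof (rule nn_integral_mono)
    fix z
    have "ennreal ((norm (fst z - snd z))\<^sup>2) \<le> ennreal (2 * c (T (fst z)) (T (snd z)) + 4 * \<eta>
      + 4 * tail R (fst z) + 4 * tail R (snd z))"
      by (rule ennreal_leI[OF upper])
    also have "\<dots> = 2 * ennreal (c (T (fst z)) (T (snd z))) + ennreal (4 * \<eta>)
      + 4 * ennreal (tail R (fst z)) + 4 * ennreal (tail R (snd z))"
      using c0 tail0 \<eta> by (simp add: ennreal_plus ennreal_mult)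
    finally show "ennreal ((norm (fst z - snd z))\<^sup>2) \<le> 2 * ennreal (c (T (fst z)) (T (snd z)))
      + ennreal (4 * \<eta>) + 4 * ennreal (tail R (fst z)) + 4 * ennreal (tail R (snd z))" .
  qed
  also have "\<dots> = 2 * ennreal (\<Sum>i\<le>n. \<Sum>j\<le>n. w i j * c i j) + ennreal (4 * \<eta>)
      + 4 * (\<integral>\<^sup>+z. tail R (fst z) \<partial>\<pi>) + 4 * (\<integral>\<^sup>+z. tail R (snd z) \<partial>\<pi>)"
    by (simp add: nn_integral_add nn_integral_cmult cost P.emeasure_space_1)
  also have "\<dots> \<le> 2 * ennreal V + ennreal (4 * (e / 12)) + 4 * ennreal (e / 12) + 4 * ennreal (e / 12)"
    using w(4) \<eta>(1) tails by (intro add_mono mult_left_mono ennreal_leI) auto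
  also have "\<dots> = ennreal (2 * V) + ennreal e"
  proof -
    have "0 \<le> V" using w(1,4) c0 by (intro order_trans[OF _ w(4)] sum_nonneg) simp
    then show ?thesis
      using e by (simp add: ennreal_mult[symmetric] ennreal_plus[symmetric] del: ennreal_plus
          flip: ennreal_numeral)
  qed
  finally show "W2_squared \<mu> \<nu> \<le> ennreal (2 * V) + ennreal e" .
qed

subsection \<open>Relative entropy\<close>

lemma ext_integral_eq_integral:
  assumes "integrable M h"
  shows "ext_integral M h = ereal (\<integral>x. h x \<partial>M)"
proof -
  have "(\<integral>\<^sup>+x. ennreal (h x) \<partial>M) \<noteq> \<infinity>" "(\<integral>\<^sup>+x. ennreal (- h x) \<partial>M) \<noteq> \<infinity>"
    using assms by (auto simp: real_integrable_def)
  then show ?thesis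
    unfolding ext_integral_def real_lebesgue_integral_def[OF assms]
    by (cases "\<integral>\<^sup>+x. ennreal (h x) \<partial>M"; cases "\<integral>\<^sup>+x. ennreal (- h x) \<partial>M")
      (simp_all add: enn2ereal_ennreal)
qed

lemma rel_entropy_density_exp:
  assumes "sigma_finite_measure \<gamma>" and [measurable]: "h \<in> borel_measurable \<gamma>"
    and \<mu>: "\<mu> = density \<gamma> (\<lambda>x. ennreal (exp (h x)))" and int: "integrable \<mu> h"
  shows "rel_entropy \<gamma> \<mu> = ereal (\<integral>x. h x \<partial>\<mu>)"
proof -
  interpret sigma_finite_measure \<gamma> by fact
  have ac: "absolutely_continuous \<gamma> \<mu>"
    unfolding \<mu> by (rule absolutely_continuousI_density) simp
  have [measurable_cong]: "sets \<mu> = sets \<gamma>" unfolding \<mu> by simp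
  have "AE x in \<gamma>. ennreal (exp (h x)) = RN_deriv \<gamma> \<mu> x"
    by (rule RN_deriv_unique) (simp_all add: \<mu>)
  then have "AE x in \<mu>. ennreal (exp (h x)) = RN_deriv \<gamma> \<mu> x"
    by (intro absolutely_continuous_AE[OF _ ac]) (simp_all add: \<mu>)
  then have AE: "AE x in \<mu>. ln (enn2real (RN_deriv \<gamma> \<mu> x)) = h x"
    by eventually_elim (metis enn2real_ennreal exp_ge_zero ln_exp)
  have "ext_integral \<mu> (\<lambda>x. ln (enn2real (RN_deriv \<gamma> \<mu> x))) = ext_integral \<mu> h"
    unfolding ext_integral_def using AE
    by (intro arg_cong2[where f = minus] arg_cong[where f = enn2ereal] nn_integral_cong_AE) auto
  then show ?thesis
    using ac ext_integral_eq_integral[OF int] by (simp add: rel_entropy_def)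
qed

text \<open>The negative part of the logarithm is harmless: \<open>r * - ln r \<le> 1\<close>, so
  its \<mu>-integral is at most the total mass of \<gamma>. Hence infinity is the only value that is
  not real.\<close>

lemma rel_entropy_finite_cases:
  assumes "finite_measure \<gamma>" "sets \<mu> = sets \<gamma>"
  obtains (infinite) "rel_entropy \<gamma> \<mu> = \<infinity>"
  | (finite) "absolutely_continuous \<gamma> \<mu>" "integrable \<mu> (\<lambda>x. ln (enn2real (RN_deriv \<gamma> \<mu> x)))"
      "rel_entropy \<gamma> \<mu> = ereal (\<integral>x. ln (enn2real (RN_deriv \<gamma> \<mu> x)) \<partial>\<mu>)"
proof (cases "absolutely_continuous \<gamma> \<mu>")
  case False
  then show thesis by (intro infinite) (simp add: rel_entropy_def)
next
  case ac: True
  interpret finite_measure \<gamma> by fact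
  note [measurable_cong] = assms(2)
  define h where "h x = ln (enn2real (RN_deriv \<gamma> \<mu> x))" for x
  have h_meas[measurable]: "h \<in> borel_measurable \<gamma>" unfolding h_def by measurable
  have "(\<integral>\<^sup>+x. ennreal (- h x) \<partial>\<mu>) = (\<integral>\<^sup>+x. ennreal (- h x) \<partial>density \<gamma> (RN_deriv \<gamma> \<mu>))"
    by (simp add: density_RN_deriv[OF ac assms(2)])
  also have "\<dots> = (\<integral>\<^sup>+x. RN_deriv \<gamma> \<mu> x * ennreal (- h x) \<partial>\<gamma>)"
    by (subst nn_integral_density) auto
  also have "\<dots> \<le> (\<integral>\<^sup>+x. 1 \<partial>\<gamma>)"
  proof (rule nn_integral_mono)
    fix x
    show "RN_deriv \<gamma> \<mu> x * ennreal (- h x) \<le> 1"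
    proof (cases "RN_deriv \<gamma> \<mu> x")
      case (real r)
      show ?thesis
      proof (cases "r = 0 \<or> - ln r \<le> 0")
        case True
        with real show ?thesis by (auto simp: h_def ennreal_neg)
      next
        case False
        with real have r: "0 < r" "0 \<le> - ln r" by auto
        have "- ln r \<le> 1 / r"
          using ln_le_minus_one[of "1 / r"] r by (simp add: ln_div)
        then have "r * - ln r \<le> 1" using r by (simp add: field_simps)
        then show ?thesis
          using r real by (simp add: h_def ennreal_mult[symmetric] ennreal_le_1)
      qed
    \<comment> \<open>Where the derivative is infinite, \<open>enn2real\<close> gives 0 and
      \<open>ln 0 = 0\<close>, so the product is 0.\<close>
    qed (simp add: h_def)
  qed
  also have "\<dots> < \<infinity>" by (simp add: emeasure_eq_measure)
  finally have N: "(\<integral>\<^sup>+x. ennreal (- h x) \<partial>\<mu>) \<noteq> \<infinity>" by simp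
  show thesis
  proof (cases "(\<integral>\<^sup>+x. ennreal (h x) \<partial>\<mu>) = \<infinity>")
    case True
    with N have "ext_integral \<mu> h = \<infinity>"
      unfolding ext_integral_def
      by (cases "\<integral>\<^sup>+x. ennreal (- h x) \<partial>\<mu>") (simp_all add: enn2ereal_ennreal)
    then show thesis using ac by (intro infinite) (simp add: rel_entropy_def h_def[abs_def])
  next
    case False
    with N have int: "integrable \<mu> h" by (simp add: real_integrable_def)
    show thesis
      using ac int ext_integral_eq_integral[OF int]
      by (intro finite) (simp_all add: rel_entropy_def h_def[abs_def])
  qed
qed

text \<open>The exponentiated form avoids the junk value of \<open>ln\<close> at \<open>0\<close>.\<close>

lemma gibbs_variational:
  fixes u :: "'a \<Rightarrow> real"
  assumes "sigma_finite_measure \<gamma>" "prob_space \<mu>" "sets \<mu> = sets \<gamma>" "absolutely_continuous \<gamma> \<mu>"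
    and h: "integrable \<mu> (\<lambda>x. ln (enn2real (RN_deriv \<gamma> \<mu> x)))"
    and u[measurable]: "u \<in> borel_measurable \<gamma>" and "integrable \<mu> u" and eu: "integrable \<gamma> (\<lambda>x. exp (u x))"
  shows "exp ((\<integral>x. u x \<partial>\<mu>) - (\<integral>x. ln (enn2real (RN_deriv \<gamma> \<mu> x)) \<partial>\<mu>)) \<le> (\<integral>x. exp (u x) \<partial>\<gamma>)"
proof -
  interpret sigma_finite_measure \<gamma> by fact
  interpret M: prob_space \<mu> by fact
  note [measurable_cong] = assms(3)
  define h where "h x = ln (enn2real (RN_deriv \<gamma> \<mu> x))" for x
  have h_meas[measurable]: "h \<in> borel_measurable \<gamma>" unfolding h_def by measurable
  have h_int: "integrable \<mu> h" using h by (simp add: h_def[abs_def])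
  have fin: "AE x in \<gamma>. RN_deriv \<gamma> \<mu> x \<noteq> \<infinity>"
    by (rule RN_deriv_finite) (use assms M.sigma_finite_measure_axioms in auto)
  have "(\<integral>\<^sup>+x. ennreal (exp (u x - h x)) \<partial>\<mu>)
      = (\<integral>\<^sup>+x. ennreal (exp (u x - h x)) \<partial>density \<gamma> (RN_deriv \<gamma> \<mu>))"
    by (simp add: density_RN_deriv[OF assms(4,3)])
  also have "\<dots> = (\<integral>\<^sup>+x. RN_deriv \<gamma> \<mu> x * ennreal (exp (u x - h x)) \<partial>\<gamma>)"
    by (subst nn_integral_density) auto
  \<comment> \<open>Equality holds where the density \<open>r\<close> is positive, as
    \<open>r * exp (u - ln r) = exp u\<close>; where it vanishes the left side is 0.\<close>
  also have "\<dots> \<le> (\<integral>\<^sup>+x. ennreal (exp (u x)) \<partial>\<gamma>)"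
  proof (rule nn_integral_mono_AE, use fin in eventually_elim)
    case (elim x)
    then obtain r where r: "RN_deriv \<gamma> \<mu> x = ennreal r" "0 \<le> r"
      by (cases "RN_deriv \<gamma> \<mu> x") auto
    then show ?case
      by (cases "r = 0") (auto simp: h_def exp_diff ennreal_mult[symmetric])
  qed
  also have "\<dots> = ennreal (\<integral>x. exp (u x) \<partial>\<gamma>)"
    by (rule nn_integral_eq_integral[OF eu]) simp
  finally have le: "(\<integral>\<^sup>+x. ennreal (exp (u x - h x)) \<partial>\<mu>) \<le> ennreal (\<integral>x. exp (u x) \<partial>\<gamma>)" .
  then have e_int: "integrable \<mu> (\<lambda>x. exp (u x - h x))"
    by (intro integrableI_nonneg) (auto simp: le_less_trans)
  have e_le: "(\<integral>x. exp (u x - h x) \<partial>\<mu>) \<le> (\<integral>x. exp (u x) \<partial>\<gamma>)"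
    using le nn_integral_eq_integral[OF e_int] by (simp add: ennreal_le_iff integral_nonneg_AE)
  define m where "m = (\<integral>x. u x \<partial>\<mu>) - (\<integral>x. h x \<partial>\<mu>)"
  \<comment> \<open>Jensen's inequality for \<open>exp\<close>, obtained from its tangent at the
    mean \<open>m\<close> of \<open>u - h\<close>.\<close>
  have "exp m = (\<integral>x. exp m * (1 + (u x - h x - m)) \<partial>\<mu>)"
    using assms(7) h_int by (simp add: M.prob_space m_def)
  also have "\<dots> \<le> (\<integral>x. exp (u x - h x) \<partial>\<mu>)"
  proof (rule integral_mono)
    fix x
    have "exp m * (1 + (u x - h x - m)) \<le> exp m * exp (u x - h x - m)"
      by (intro mult_left_mono exp_ge_add_one_self) simp
    then show "exp m * (1 + (u x - h x - m)) \<le> exp (u x - h x)" by (simp add: exp_diff)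
  qed (use assms(7) h_int e_int in auto)
  finally show ?thesis using e_le by (simp add: m_def h_def)
qed

text \<open>Gibbs bounds the means of the truncations \<open>min (u x) n\<close> by
  \<open>E + ln Z\<close>, uniformly in \<open>n\<close>, and monotone convergence removes the
  truncation. With \<open>u\<close> a quarter of the squared norm, finite entropy yields a finite
  second moment.\<close>

lemma integrable_if_exp_integrable:
  fixes u :: "'a \<Rightarrow> real"
  assumes "finite_measure \<gamma>" "prob_space \<mu>" "sets \<mu> = sets \<gamma>" "absolutely_continuous \<gamma> \<mu>"
    and h: "integrable \<mu> (\<lambda>x. ln (enn2real (RN_deriv \<gamma> \<mu> x)))"
    and u[measurable]: "u \<in> borel_measurable \<gamma>" and u0: "\<And>x. 0 \<le> u x"
    and eu: "integrable \<gamma> (\<lambda>x. exp (u x))"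
  shows "integrable \<mu> u"
proof -
  interpret finite_measure \<gamma> by fact
  interpret M: prob_space \<mu> by fact
  note [measurable_cong] = assms(3)
  define E where "E = (\<integral>x. ln (enn2real (RN_deriv \<gamma> \<mu> x)) \<partial>\<mu>)"
  define Z where "Z = (\<integral>x. exp (u x) \<partial>\<gamma>)"
  have bound: "(\<integral>\<^sup>+x. ennreal (min (u x) (real n)) \<partial>\<mu>) \<le> ennreal (E + ln Z)" for n
  proof -
    have i\<mu>: "integrable \<mu> (\<lambda>x. min (u x) (real n))"
      by (rule M.integrable_const_bound[where B = n]) (auto simp: u0 min_def)
    have i\<gamma>: "integrable \<gamma> (\<lambda>x. exp (min (u x) (real n)))"
      by (rule Bochner_Integration.integrable_bound[OF eu]) auto
    have "exp ((\<integral>x. min (u x) (real n) \<partial>\<mu>) - E) \<le> (\<integral>x. exp (min (u x) (real n)) \<partial>\<gamma>)"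
      unfolding E_def
      by (rule gibbs_variational[OF sigma_finite_measure_axioms assms(2-4) h _ i\<mu> i\<gamma>]) measurable
    also have "\<dots> \<le> Z" unfolding Z_def by (rule integral_mono[OF i\<gamma> eu]) simp
    finally have le: "exp ((\<integral>x. min (u x) (real n) \<partial>\<mu>) - E) \<le> Z" .
    then have "0 < Z" using exp_gt_zero less_le_trans by blast
    with le have "(\<integral>x. min (u x) (real n) \<partial>\<mu>) - E \<le> ln Z" by (simp add: ln_ge_iff)
    then show ?thesis
      by (subst nn_integral_eq_integral[OF i\<mu>]) (auto simp: u0 intro!: ennreal_leI)
  qed
  have "(\<integral>\<^sup>+x. ennreal (u x) \<partial>\<mu>) = (\<integral>\<^sup>+x. (SUP n::nat. ennreal (min (u x) (real n))) \<partial>\<mu>)"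
  proof (rule nn_integral_cong)
    fix x
    obtain N :: nat where N: "u x \<le> real N" using real_arch_simple by blast
    show "ennreal (u x) = (SUP n::nat. ennreal (min (u x) (real n)))"
    proof (rule antisym)
      show "ennreal (u x) \<le> (SUP n::nat. ennreal (min (u x) (real n)))"
        using N by (intro SUP_upper2[of N]) auto
    qed (auto intro!: SUP_least ennreal_leI)
  qed
  also have "\<dots> = (SUP n::nat. \<integral>\<^sup>+x. ennreal (min (u x) (real n)) \<partial>\<mu>)"
    by (rule nn_integral_monotone_convergence_SUP)
      (auto simp: incseq_def le_fun_def intro!: ennreal_leI)
  also have "\<dots> \<le> ennreal (E + ln Z)" by (intro SUP_least bound)
  finally show ?thesis by (intro integrableI_nonneg) (auto simp: u0 le_less_trans)
qed

subsection \<open>Gaussian integrals and centering\<close>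

lemma nn_integral_exp_neg_abs_finite:
  fixes c :: real
  assumes "0 < c"
  shows "(\<integral>\<^sup>+t. ennreal (exp (- c * \<bar>t\<bar>)) \<partial>lborel) < \<infinity>"
proof -
  define d where "d = exponential_density c"
  have d0: "0 \<le> d t" for t using assms by (simp add: d_def exponential_density_def)
  have d_meas[measurable]: "d \<in> borel_measurable borel" unfolding d_def by measurable
  have "emeasure (density lborel d) (space (density lborel d)) = 1"
    using prob_space_exponential_density[OF assms] unfolding d_def
    by (rule prob_space.emeasure_space_1)
  then have d1: "(\<integral>\<^sup>+t. ennreal (d t) \<partial>lborel) = 1" by (simp add: emeasure_density)
  have d2: "(\<integral>\<^sup>+t. ennreal (d (- t)) \<partial>lborel) = 1"
    using d1 nn_integral_real_affine[of "\<lambda>t. ennreal (d t)" "- 1" 0] by simp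
  have "(\<integral>\<^sup>+t. ennreal (exp (- c * \<bar>t\<bar>)) \<partial>lborel)
      \<le> (\<integral>\<^sup>+t. ennreal (1 / c) * (ennreal (d t) + ennreal (d (- t))) \<partial>lborel)"
  proof (rule nn_integral_mono)
    fix t
    have "exp (- c * \<bar>t\<bar>) \<le> 1 / c * (d t + d (- t))"
      using assms by (auto simp: d_def exponential_density_def field_simps abs_if)
    then show "ennreal (exp (- c * \<bar>t\<bar>)) \<le> ennreal (1 / c) * (ennreal (d t) + ennreal (d (- t)))"
      using d0 assms by (simp add: ennreal_mult[symmetric] ennreal_plus[symmetric] ennreal_leI
          del: ennreal_plus)
  qed
  also have "\<dots> = ennreal (1 / c) * (1 + 1)"
    by (subst nn_integral_cmult, simp, subst nn_integral_add) (simp_all add: d1 d2)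
  also have "\<dots> < \<infinity>" by (simp add: ennreal_mult_less_top)
  finally show ?thesis .
qed

lemma integrable_exp_neg_norm:
  assumes "0 < K"
  shows "integrable lborel (\<lambda>x::'a::euclidean_space. exp (- K * norm x))"
proof (rule integrableI_nonneg)
  \<comment> \<open>Each coordinate is at most \<open>norm x\<close> in absolute value, so the rate
    \<open>K\<close> is shared equally among the coordinates and the bound factorises.\<close>
  define c where "c = K / DIM('a)"
  have c: "0 < c" using assms by (simp add: c_def)
  have "(\<integral>\<^sup>+(x::'a). ennreal (exp (- K * norm x)) \<partial>lborel)
      \<le> (\<integral>\<^sup>+(x::'a). (\<Prod>b\<in>Basis. ennreal (exp (- c * \<bar>x \<bullet> b\<bar>))) \<partial>lborel)"
  proof (rule nn_integral_mono)
    fix x :: 'a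
    have "(\<Sum>b\<in>Basis. c * \<bar>x \<bullet> b\<bar>) \<le> (\<Sum>b\<in>(Basis::'a set). c * norm x)"
      using c by (intro sum_mono mult_left_mono) (auto simp: Basis_le_norm)
    then have "exp (- K * norm x) \<le> exp (\<Sum>b\<in>Basis. - c * \<bar>x \<bullet> b\<bar>)"
      by (simp add: c_def sum_negf)
    then show "ennreal (exp (- K * norm x)) \<le> (\<Prod>b\<in>Basis. ennreal (exp (- c * \<bar>x \<bullet> b\<bar>)))"
      by (simp add: prod_ennreal exp_sum ennreal_leI)
  qed
  also have "\<dots> = (\<Prod>b\<in>(Basis::'a set). \<integral>\<^sup>+t. ennreal (exp (- c * \<bar>t\<bar>)) \<partial>lborel)"
    by (rule nn_integral_lborel_prod) auto
  also have "\<dots> < \<infinity>"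
    using nn_integral_exp_neg_abs_finite[OF c] by (simp add: power_less_top_ennreal)
  finally show "(\<integral>\<^sup>+(x::'a). ennreal (exp (- K * norm x)) \<partial>lborel) < \<infinity>" .
qed auto

section \<open>Integrability against the standard Gaussian\<close>

definition gauss_density :: "'a::euclidean_space \<Rightarrow> real" where
  "gauss_density x = (2 * pi) powr (- real DIM('a) / 2) * exp (- (norm x)\<^sup>2 / 2)"

lemma gauss_density_pos: "0 < gauss_density x"
  by (simp add: gauss_density_def)

lemma gauss_density_measurable [measurable]: "gauss_density \<in> borel_measurable borel"
  unfolding gauss_density_def by measurable

lemma std_gaussian_eq: "std_gaussian = density lborel (\<lambda>x. ennreal (gauss_density x))"
  by (simp add: std_gaussian_def gauss_density_def)

lemma sets_std_gaussian [measurable_cong, simp]: "sets std_gaussian = sets borel"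
  by (simp add: std_gaussian_def)

text \<open>The coefficient 1/4 is below the Gaussian 1/2, so a quadratic decay survives and absorbs
  any linear exponent. The form covers both exponential tilts and the exponential square moment used
  for second moments.\<close>

lemma integrable_std_gaussianI:
  fixes F :: "'a::euclidean_space \<Rightarrow> 'b::{banach, second_countable_topology}"
  assumes [measurable]: "F \<in> borel_measurable borel"
    and F: "\<And>x. norm (F x) \<le> C * exp (K * norm x + (norm x)\<^sup>2 / 4)"
  shows "integrable std_gaussian F"
proof -
  define k where "k = (2 * pi) powr (- real DIM('a) / 2)"
  have "0 \<le> C * exp (K * norm (0::'a) + (norm (0::'a))\<^sup>2 / 4)"
    using F[of 0] norm_ge_zero order_trans by blast
  then have C: "0 \<le> C" by simp
  have "integrable lborel (\<lambda>x. gauss_density x *\<^sub>R F x)"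
  proof (rule Bochner_Integration.integrable_bound)
    show "integrable lborel (\<lambda>x::'a. (k * C * exp ((K + 1)\<^sup>2)) * exp (- 1 * norm x))"
      by (intro integrable_mult_right integrable_exp_neg_norm) simp
    show "AE x in lborel. norm (gauss_density x *\<^sub>R F x)
        \<le> norm ((k * C * exp ((K + 1)\<^sup>2)) * exp (- 1 * norm x))"
    proof (rule AE_I2)
      fix x :: 'a
      \<comment> \<open>Completing the square with \<open>K + 1\<close> instead of \<open>K\<close>
        leaves a spare factor \<open>exp (- norm x)\<close>.\<close>
      have "0 \<le> (norm x / 2 - (K + 1))\<^sup>2" by simp
      then have "K * norm x + (norm x)\<^sup>2 / 4 - (norm x)\<^sup>2 / 2 \<le> (K + 1)\<^sup>2 - norm x"
        by (simp add: power2_eq_square field_simps)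
      then have le: "exp (- (norm x)\<^sup>2 / 2) * exp (K * norm x + (norm x)\<^sup>2 / 4)
          \<le> exp ((K + 1)\<^sup>2) * exp (- 1 * norm x)"
        by (simp add: exp_add[symmetric])
      have "norm (gauss_density x *\<^sub>R F x) = k * exp (- (norm x)\<^sup>2 / 2) * norm (F x)"
        by (simp add: gauss_density_def k_def)
      also have "\<dots> \<le> k * exp (- (norm x)\<^sup>2 / 2) * (C * exp (K * norm x + (norm x)\<^sup>2 / 4))"
        by (intro mult_left_mono F) (simp add: k_def)
      also have "\<dots> = (k * C) * (exp (- (norm x)\<^sup>2 / 2) * exp (K * norm x + (norm x)\<^sup>2 / 4))"
        by simp
      also have "\<dots> \<le> (k * C) * (exp ((K + 1)\<^sup>2) * exp (- 1 * norm x))"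
        using C by (intro mult_left_mono le) (simp add: k_def)
      finally show "norm (gauss_density x *\<^sub>R F x)
        \<le> norm ((k * C * exp ((K + 1)\<^sup>2)) * exp (- 1 * norm x))"
        using C by (simp add: k_def mult.assoc)
    qed
  qed simp
  then show ?thesis
    unfolding std_gaussian_eq
    by (subst integrable_density) (auto simp: less_imp_le[OF gauss_density_pos])
qed

lemma finite_measure_std_gaussian: "finite_measure (std_gaussian :: 'a::euclidean_space measure)"
proof
  have "integrable (std_gaussian :: 'a measure) (\<lambda>_. 1 :: real)"
    by (rule integrable_std_gaussianI[where C = 1 and K = 0]) auto
  then have "(\<integral>\<^sup>+(x::'a). 1 \<partial>std_gaussian) < \<infinity>"
    by (auto simp: integrable_iff_bounded)
  then show "emeasure std_gaussian (space (std_gaussian :: 'a measure)) \<noteq> \<infinity>" by simp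
qed

text \<open>The tilt minimises \<open>a \<mapsto> \<integral> exp (\<phi> x - a \<bullet> x) d\<gamma>\<close>; the vanishing of the barycentre is
  the first-order condition.\<close>

lemma exists_centering_tilt:
  fixes \<phi> :: "'a::euclidean_space \<Rightarrow> real"
  assumes \<phi>[measurable]: "\<phi> \<in> borel_measurable borel" and bd: "bounded (range \<phi>)"
  obtains a where "(\<integral>x. exp (\<phi> x - a \<bullet> x) *\<^sub>R x \<partial>std_gaussian) = 0"
proof -
  obtain M where M: "\<And>x. \<bar>\<phi> x\<bar> \<le> M" using bd by (auto simp: bounded_iff)
  define F where "F a = (\<integral>x. exp (\<phi> x - a \<bullet> x) \<partial>std_gaussian)" for a
  have dom: "exp (\<phi> x - a \<bullet> x) \<le> exp M * exp (K * norm x)" if "norm a \<le> K" for a x K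
  proof -
    have "- (a \<bullet> x) \<le> norm a * norm x" using Cauchy_Schwarz_ineq2[of a x] by linarith
    also have "\<dots> \<le> K * norm x" using that by (rule mult_right_mono) simp
    finally show ?thesis using M[of x] by (simp add: exp_add[symmetric])
  qed
  have int_exp: "integrable std_gaussian (\<lambda>x::'a. C * exp (K * norm x))" for C K
    by (rule integrable_std_gaussianI[where C = "\<bar>C\<bar>" and K = K])
      (auto simp: abs_mult intro!: mult_left_mono)
  have int_F: "integrable std_gaussian (\<lambda>x. exp (\<phi> x - a \<bullet> x))" for a
    by (rule Bochner_Integration.integrable_bound[OF int_exp[of "exp M" "norm a"]])
      (use dom[of a "norm a"] in auto)
  have cont: "continuous_on (cball 0 K) F" for K
    unfolding continuous_on_sequentially
  proof (intro allI ballI impI, elim conjE)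
    fix as and a :: 'a assume as: "\<forall>n. as n \<in> cball 0 K" "as \<longlonglongrightarrow> a"
    have "(\<lambda>n. \<integral>x. exp (\<phi> x - as n \<bullet> x) \<partial>std_gaussian) \<longlonglongrightarrow> (\<integral>x. exp (\<phi> x - a \<bullet> x) \<partial>std_gaussian)"
    proof (rule integral_dominated_convergence[where w = "\<lambda>x. exp M * exp (K * norm x)"])
      show "AE x in std_gaussian. (\<lambda>n. exp (\<phi> x - as n \<bullet> x)) \<longlonglongrightarrow> exp (\<phi> x - a \<bullet> x)"
        using as(2) by (intro AE_I2 tendsto_intros)
      show "AE x in std_gaussian. norm (exp (\<phi> x - as n \<bullet> x)) \<le> exp M * exp (K * norm x)" for n
        using as(1) dom by auto
    qed (use int_exp[of "exp M" K] in auto)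
    then show "(F \<circ> as) \<longlonglongrightarrow> F a" by (simp add: F_def comp_def)
  qed
  \<comment> \<open>A lower bound for the Gaussian mass of a unit ball centred at distance 2 from
    the origin: \<open>norm x \<le> 3\<close> there, whence the exponent -9/2.\<close>
  define m where "m = (2 * pi) powr (- real DIM('a) / 2) * exp (- 9 / 2) * measure lborel (ball (0::'a) 1)"
  have m: "0 < m" by (simp add: m_def content_ball_pos)
  have coercive: "m * exp (norm a - M) \<le> F a" if "a \<noteq> 0" for a
  proof -
    \<comment> \<open>The centre lies at distance 2 in the direction opposite to \<open>a\<close>,
      where \<open>- (a \<bullet> x)\<close> is \<open>2 * norm a\<close>; moving by less than 1
      costs at most \<open>norm a\<close>.\<close>
    define B where "B = ball (- (2 / norm a) *\<^sub>R a) 1"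
    have B: "norm x \<le> 3" "norm a \<le> - (a \<bullet> x)" if "x \<in> B" for x
    proof -
      define z where "z = x + (2 / norm a) *\<^sub>R a"
      have z: "norm z < 1" using that by (simp add: B_def z_def dist_norm norm_minus_commute)
      have x: "x = z - (2 / norm a) *\<^sub>R a" by (simp add: z_def)
      show "norm x \<le> 3"
        using norm_triangle_ineq4[of z "(2 / norm a) *\<^sub>R a"] z \<open>a \<noteq> 0\<close> by (simp add: x)
      have "a \<bullet> z \<le> norm a * 1"
        using Cauchy_Schwarz_ineq2[of a z] mult_left_mono[OF less_imp_le[OF z] norm_ge_zero[of a]] by linarith
      moreover have "a \<bullet> x = a \<bullet> z - 2 * norm a"
        using \<open>a \<noteq> 0\<close> by (simp add: x inner_diff_right power2_norm_eq_inner[symmetric] power2_eq_square)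
      ultimately show "norm a \<le> - (a \<bullet> x)" by simp
    qed
    have "m * exp (norm a - M) = (\<integral>x. (2 * pi) powr (- real DIM('a) / 2) * exp (- 9 / 2)
        * exp (norm a - M) * indicator B x \<partial>lborel)"
      by (simp add: m_def B_def content_ball)
    also have "\<dots> \<le> (\<integral>x. gauss_density x * exp (\<phi> x - a \<bullet> x) \<partial>lborel)"
    proof (rule integral_mono)
      show "integrable lborel (\<lambda>x. gauss_density x * exp (\<phi> x - a \<bullet> x))"
        using int_F[of a] unfolding std_gaussian_eq
        by (subst (asm) integrable_density) (auto simp: less_imp_le[OF gauss_density_pos])
      show "integrable lborel (\<lambda>x. (2 * pi) powr (- real DIM('a) / 2) * exp (- 9 / 2)
        * exp (norm a - M) * indicator B x)"
        unfolding B_def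
        by (intro integrable_mult_right integrable_real_indicator emeasure_bounded_finite) auto
      fix x
      show "(2 * pi) powr (- real DIM('a) / 2) * exp (- 9 / 2) * exp (norm a - M) * indicator B x
        \<le> gauss_density x * exp (\<phi> x - a \<bullet> x)"
      proof (cases "x \<in> B")
        case True
        have "(norm x)\<^sup>2 \<le> 3\<^sup>2" using B(1)[OF True] by (intro power_mono) auto
        then have "exp (- 9 / 2) \<le> exp (- (norm x)\<^sup>2 / 2)" by simp
        moreover have "exp (norm a - M) \<le> exp (\<phi> x - a \<bullet> x)"
          using B(2)[OF True] M[of x] by (simp add: abs_le_iff)
        ultimately show ?thesis
          using True unfolding gauss_density_def by (simp add: mult_mono mult.assoc)
      next
        case False
        then show ?thesis using gauss_density_pos[of x] by simp
      qed
    qed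
    also have "\<dots> = F a"
      unfolding F_def std_gaussian_eq
      by (subst integral_density) (auto simp: less_imp_le[OF gauss_density_pos])
    finally show ?thesis .
  qed
  \<comment> \<open>Beyond this radius the bound of \<open>coercive\<close> exceeds
    \<open>F 0\<close>. The maximum with 1 puts 0 into the ball and excludes it from the
    outside.\<close>
  define K where "K = max 1 (M + ln (F 0 / m) + 1)"
  have F0: "0 < F 0"
  proof -
    have "0 \<le> F 0" unfolding F_def by simp
    moreover have "F 0 \<noteq> 0"
    proof
      assume "F 0 = 0"
      then have "AE x in std_gaussian :: 'a measure. exp (\<phi> x - 0 \<bullet> x) = 0"
        unfolding F_def using int_F[of 0] by (subst (asm) integral_nonneg_eq_0_iff_AE) auto
      then have "AE x in std_gaussian :: 'a measure. False" by simp
      then have "AE x in lborel :: 'a measure. False"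
        unfolding std_gaussian_eq by (subst (asm) AE_density) (auto simp: gauss_density_pos)
      then show False by (simp add: AE_iff_null null_sets_def emeasure_lborel_UNIV)
    qed
    ultimately show ?thesis by simp
  qed
  have far: "F 0 \<le> F a" if "K < norm a" for a
  proof -
    have "F 0 = m * exp (ln (F 0 / m))" using m F0 by simp
    also have "\<dots> \<le> m * exp (norm a - M)"
      using that m by (intro mult_left_mono) (auto simp: K_def)
    also have "\<dots> \<le> F a" using that by (intro coercive) (auto simp: K_def)
    finally show ?thesis .
  qed
  obtain a where a: "a \<in> cball 0 K" "\<And>y. y \<in> cball 0 K \<Longrightarrow> F a \<le> F y"
    using continuous_attains_inf[OF compact_cball _ cont[of K]] by (auto simp: K_def)
  have min: "F a \<le> F y" for y
  proof (cases "norm y \<le> K")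
    case False
    have "F a \<le> F 0" by (rule a(2)) (simp add: K_def)
    with far[of y] False show ?thesis by simp
  qed (use a in simp)
  define G where "G x = exp (\<phi> x - a \<bullet> x) *\<^sub>R x" for x
  have G_meas[measurable]: "G \<in> borel_measurable borel" unfolding G_def by measurable
  have int_G: "integrable std_gaussian G"
  proof (rule Bochner_Integration.integrable_bound[OF int_exp[of "exp M" "norm a + 1"]])
    show "AE x in std_gaussian. norm (G x) \<le> norm (exp M * exp ((norm a + 1) * norm x))"
    proof (rule AE_I2)
      fix x :: 'a
      have "norm x \<le> exp (norm x)" using exp_ge_add_one_self[of "norm x"] by linarith
      then have "norm (G x) \<le> (exp M * exp (norm a * norm x)) * exp (norm x)"
        unfolding G_def using dom[of a "norm a" x] by (auto intro!: mult_mono)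
      then show "norm (G x) \<le> norm (exp M * exp ((norm a + 1) * norm x))"
        by (simp add: exp_add[symmetric] algebra_simps)
    qed
  qed simp
  \<comment> \<open>A one-sided directional derivative at the minimiser, along the steps
    \<open>t n\<close>. Convexity of \<open>exp\<close> bounds the difference quotients, so no
    differentiation under the integral occurs.\<close>
  have le0: "v \<bullet> (\<integral>x. G x \<partial>std_gaussian) \<le> 0" for v
  proof -
    define t where "t n = inverse (real (Suc n))" for n
    define g :: "nat \<Rightarrow> 'a \<Rightarrow> real" where "g n x = (v \<bullet> x) * exp (\<phi> x - (a + t n *\<^sub>R v) \<bullet> x)" for n x
    have t: "0 < t n" "t n \<le> 1" for n by (auto simp: t_def inverse_le_1_iff)
    have g_meas[measurable]: "g n \<in> borel_measurable borel" for n unfolding g_def by measurable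
    \<comment> \<open>One \<open>norm v\<close> pays for the perturbation of \<open>a\<close>, as
      \<open>t n \<le> 1\<close>; the other absorbs the factor \<open>v \<bullet> x\<close>.\<close>
    have g_dom: "norm (g n x) \<le> exp M * exp ((norm a + 2 * norm v) * norm x)" for n x
    proof -
      have "\<bar>v \<bullet> x\<bar> \<le> norm v * norm x" by (rule Cauchy_Schwarz_ineq2)
      also have "\<dots> \<le> exp (norm v * norm x)"
        using exp_ge_add_one_self[of "norm v * norm x"] by linarith
      finally have 1: "\<bar>v \<bullet> x\<bar> \<le> exp (norm v * norm x)" .
      have "norm (a + t n *\<^sub>R v) \<le> norm a + t n * norm v"
        using norm_triangle_ineq[of a "t n *\<^sub>R v"] t(1)[of n] by simp
      also have "\<dots> \<le> norm a + 1 * norm v"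
        using t(2)[of n] by (intro add_mono mult_right_mono) auto
      finally have 2: "exp (\<phi> x - (a + t n *\<^sub>R v) \<bullet> x) \<le> exp M * exp ((norm a + norm v) * norm x)"
        by (intro dom) simp
      have "norm (g n x) \<le> exp (norm v * norm x) * (exp M * exp ((norm a + norm v) * norm x))"
        unfolding g_def norm_mult using 1 2 by (intro mult_mono) auto
      then show ?thesis by (simp add: exp_add[symmetric] algebra_simps)
    qed
    have int_g: "integrable std_gaussian (g n)" for n
      by (rule Bochner_Integration.integrable_bound[OF int_exp[of "exp M" "norm a + 2 * norm v"]])
        (use g_dom in auto)
    have "(\<lambda>n. \<integral>x. g n x \<partial>std_gaussian) \<longlonglongrightarrow> (\<integral>x. v \<bullet> G x \<partial>std_gaussian)"
    proof (rule integral_dominated_convergence[where w = "\<lambda>x. exp M * exp ((norm a + 2 * norm v) * norm x)"])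
      have "t \<longlonglongrightarrow> 0" unfolding t_def by (rule LIMSEQ_inverse_real_of_nat)
      then have "(\<lambda>n. g n x) \<longlonglongrightarrow> (v \<bullet> x) * exp (\<phi> x - (a + 0 *\<^sub>R v) \<bullet> x)" for x
        unfolding g_def by (intro tendsto_intros)
      then show "AE x in std_gaussian. (\<lambda>n. g n x) \<longlonglongrightarrow> v \<bullet> G x"
        by (simp add: G_def mult.commute)
    qed (use g_dom int_exp[of "exp M" "norm a + 2 * norm v"] in auto)
    moreover have "(\<integral>x. g n x \<partial>std_gaussian) \<le> 0" for n
    proof -
      have "0 \<le> F (a + t n *\<^sub>R v) - F a" using min by simp
      also have "\<dots> = (\<integral>x. exp (\<phi> x - (a + t n *\<^sub>R v) \<bullet> x) - exp (\<phi> x - a \<bullet> x) \<partial>std_gaussian)"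
        unfolding F_def by (simp add: int_F)
      also have "\<dots> \<le> (\<integral>x. - t n * g n x \<partial>std_gaussian)"
      proof (rule integral_mono)
        fix x
        define s where "s = t n * (v \<bullet> x)"
        define y where "y = \<phi> x - (a + t n *\<^sub>R v) \<bullet> x"
        \<comment> \<open>The tangent is taken at the perturbed exponent \<open>y\<close>, so that
          the inequality has the sign needed to combine with minimality.\<close>
        have "exp y * (1 + s) \<le> exp y * exp s" by (intro mult_left_mono exp_ge_add_one_self) simp
        moreover have "exp y * exp s = exp (\<phi> x - a \<bullet> x)"
          by (simp add: y_def s_def exp_add[symmetric] inner_add_left)
        ultimately show "exp (\<phi> x - (a + t n *\<^sub>R v) \<bullet> x) - exp (\<phi> x - a \<bullet> x) \<le> - t n * g n x"
          unfolding g_def y_def[symmetric] by (simp add: s_def algebra_simps)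
      qed (intro Bochner_Integration.integrable_diff int_F integrable_mult_right int_g)+
      also have "\<dots> = - t n * (\<integral>x. g n x \<partial>std_gaussian)" by simp
      finally show ?thesis using t(1)[of n] by (auto simp: mult_le_0_iff zero_le_mult_iff)
    qed
    ultimately have "(\<integral>x. v \<bullet> G x \<partial>std_gaussian) \<le> 0"
      by (intro LIMSEQ_le_const2) auto
    then show ?thesis using int_G by simp
  qed
  \<comment> \<open>Choosing \<open>v\<close> as the integral itself makes its squared norm
    nonpositive.\<close>
  have "(\<integral>x. G x \<partial>std_gaussian) = 0"
    using le0[of "\<integral>x. G x \<partial>std_gaussian"] by (metis inner_eq_zero_iff inner_ge_zero order_antisym)
  then show thesis by (intro that) (simp add: G_def)
qed

subsection \<open>From Santalo to Talagrand\<close>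

text \<open>The second side of the equivalence, packaged as a hypothesis. All its variables are
  bound, so the \<open>itself\<close> argument is what fixes the space.\<close>

definition santalo_ineq :: "'a::euclidean_space itself \<Rightarrow> bool" where
  "santalo_ineq _ \<longleftrightarrow> (\<forall>f g :: 'a \<Rightarrow> real.
      f \<in> borel_measurable lebesgue \<and> g \<in> borel_measurable lebesgue \<and>
      (\<forall>x y. f x + g y \<le> - (x \<bullet> y)) \<and>
      (barycenter_zero (\<lambda>x. exp (f x)) \<or> barycenter_zero (\<lambda>x. exp (g x))) \<longrightarrow>
      (\<integral>\<^sup>+x. ennreal (exp (f x)) \<partial>lebesgue) * (\<integral>\<^sup>+x. ennreal (exp (g x)) \<partial>lebesgue)
        \<le> ennreal ((2 * pi) ^ DIM('a)))"

lemma exp_minus_half_square: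
  "exp (u - (norm x)\<^sup>2 / 2) = (2 * pi) powr (real DIM('a) / 2) * (gauss_density x * exp u)"
  for x :: "'a::euclidean_space"
proof -
  have "(2 * pi) powr (real DIM('a) / 2) * (2 * pi) powr (- real DIM('a) / 2) = 1"
    by (simp add: powr_add[symmetric])
  moreover have "exp (u - (norm x)\<^sup>2 / 2) = exp (- (norm x)\<^sup>2 / 2) * exp u"
    by (simp add: exp_add[symmetric])
  ultimately show ?thesis
    unfolding gauss_density_def by (simp only: mult.assoc[symmetric])
qed

lemma nn_integral_lborel_shift:
  fixes F :: "'a::euclidean_space \<Rightarrow> ennreal"
  assumes [measurable]: "F \<in> borel_measurable borel"
  shows "(\<integral>\<^sup>+x. F (x - a) \<partial>lborel) = (\<integral>\<^sup>+x. F x \<partial>lborel)"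
proof -
  have "(\<integral>\<^sup>+x. F x \<partial>lborel) = (\<integral>\<^sup>+x. F x \<partial>distr lborel borel ((+) (- a)))"
    by (simp add: lborel_distr_plus)
  also have "\<dots> = (\<integral>\<^sup>+x. F (- a + x) \<partial>lborel)" by (subst nn_integral_distr) auto
  finally show ?thesis by simp
qed

text \<open>Source of the Santalo constant: each function of a dual pair brings this factor once, so
  in Gaussian normalisation the bound becomes 1.\<close>

lemma nn_integral_exp_gaussian_shape:
  fixes u :: "'a::euclidean_space \<Rightarrow> real"
  assumes [measurable]: "u \<in> borel_measurable borel" and int: "integrable std_gaussian (\<lambda>x. exp (u x))"
  shows "(\<integral>\<^sup>+x. ennreal (exp (u x - (norm x)\<^sup>2 / 2)) \<partial>lborel)
    = ennreal ((2 * pi) powr (real DIM('a) / 2) * (\<integral>x. exp (u x) \<partial>std_gaussian))"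
proof -
  define k where "k = (2 * pi) powr (real DIM('a) / 2)"
  have k: "0 < k" by (simp add: k_def)
  have eq: "exp (u x - (norm x)\<^sup>2 / 2) = k * (gauss_density x * exp (u x))" for x :: 'a
    unfolding k_def by (rule exp_minus_half_square)
  have "(\<integral>\<^sup>+x. ennreal (exp (u x - (norm x)\<^sup>2 / 2)) \<partial>lborel)
      = (\<integral>\<^sup>+x. ennreal k * (ennreal (gauss_density x) * ennreal (exp (u x))) \<partial>lborel)"
    unfolding eq using k by (simp add: ennreal_mult less_imp_le[OF gauss_density_pos])
  also have "\<dots> = ennreal k * (\<integral>\<^sup>+x. ennreal (exp (u x)) \<partial>std_gaussian)"
    unfolding std_gaussian_eq by (subst nn_integral_density) (auto simp: nn_integral_cmult)
  also have "\<dots> = ennreal (k * (\<integral>x. exp (u x) \<partial>std_gaussian))"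
    using k by (subst nn_integral_eq_integral[OF int]) (auto simp: ennreal_mult)
  finally show ?thesis by (simp add: k_def)
qed

text \<open>Only \<open>\<phi>\<close> shows the tilt: the compensating translation acts on the
  Lebesgue integral of \<open>exp (g z)\<close> and disappears there, leaving \<open>\<psi>\<close>
  as it was.\<close>

lemma santalo_dual_bound:
  fixes \<phi> \<psi> :: "'a::euclidean_space \<Rightarrow> real"
  assumes santalo: "santalo_ineq TYPE('a)"
    and [measurable]: "\<phi> \<in> borel_measurable borel" "\<psi> \<in> borel_measurable borel"
    and bd: "bounded (range \<phi>)" "bounded (range \<psi>)"
    and le: "\<And>x y. \<phi> x + \<psi> y \<le> (norm (x - y))\<^sup>2 / 2"
  obtains a where
    "integrable std_gaussian (\<lambda>x. exp (\<phi> x - a \<bullet> x))" "integrable std_gaussian (\<lambda>x. exp (\<psi> x))"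
    "(\<integral>x. exp (\<phi> x - a \<bullet> x) \<partial>std_gaussian) * (\<integral>x. exp (\<psi> x) \<partial>std_gaussian) \<le> 1"
proof -
  obtain a where a: "(\<integral>x. exp (\<phi> x - a \<bullet> x) *\<^sub>R x \<partial>std_gaussian) = 0"
    using exists_centering_tilt[OF assms(2) bd(1)] .
  obtain M where M: "\<And>x. \<bar>\<phi> x\<bar> \<le> M" using bd(1) by (auto simp: bounded_iff)
  obtain N where N: "\<And>x. \<bar>\<psi> x\<bar> \<le> N" using bd(2) by (auto simp: bounded_iff)
  have dom: "exp (\<phi> x - a \<bullet> x) \<le> exp M * exp (norm a * norm x)" for x
    using M[of x] Cauchy_Schwarz_ineq2[of a x] by (simp add: exp_add[symmetric])
  have int_\<phi>: "integrable std_gaussian (\<lambda>x. exp (\<phi> x - a \<bullet> x))"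
  proof (rule integrable_std_gaussianI[where C = "exp M" and K = "norm a"])
    show "norm (exp (\<phi> x - a \<bullet> x)) \<le> exp M * exp (norm a * norm x + (norm x)\<^sup>2 / 4)" for x
      using order_trans[OF dom[of x], of "exp M * exp (norm a * norm x + (norm x)\<^sup>2 / 4)"] by simp
  qed simp
  have int_\<phi>x: "integrable std_gaussian (\<lambda>x. exp (\<phi> x - a \<bullet> x) *\<^sub>R x)"
  proof (rule integrable_std_gaussianI[where C = "exp M" and K = "norm a + 1"])
    fix x :: 'a
    have "norm x \<le> exp (norm x + (norm x)\<^sup>2 / 4)"
      using exp_ge_add_one_self[of "norm x + (norm x)\<^sup>2 / 4"] zero_le_power2[of "norm x"] by linarith
    then have "exp (\<phi> x - a \<bullet> x) * norm x \<le> (exp M * exp (norm a * norm x)) * exp (norm x + (norm x)\<^sup>2 / 4)"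
      by (intro mult_mono dom) auto
    then show "norm (exp (\<phi> x - a \<bullet> x) *\<^sub>R x) \<le> exp M * exp ((norm a + 1) * norm x + (norm x)\<^sup>2 / 4)"
      by (simp add: exp_add[symmetric] algebra_simps)
  qed simp
  have int_\<psi>: "integrable std_gaussian (\<lambda>x. exp (\<psi> x))"
  proof (rule integrable_std_gaussianI[where C = "exp N" and K = 0])
    show "norm (exp (\<psi> x)) \<le> exp N * exp (0 * norm x + (norm x)\<^sup>2 / 4)" for x
      using N[of x] zero_le_power2[of "norm x"] by (simp add: exp_add[symmetric] abs_le_iff add_increasing2)
  qed simp
  define F where "F = (\<integral>x. exp (\<phi> x - a \<bullet> x) \<partial>std_gaussian)"
  define G where "G = (\<integral>x. exp (\<psi> x) \<partial>std_gaussian)"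
  define k where "k = (2 * pi) powr (real DIM('a) / 2)"
  have k: "0 < k" by (simp add: k_def)
  have kk: "k * k = (2 * pi) ^ DIM('a)"
    by (simp add: k_def powr_add[symmetric] powr_realpow)
  define f where "f x = (\<phi> x - a \<bullet> x) - (norm x)\<^sup>2 / 2" for x
  \<comment> \<open>Expanding the squared distance from \<open>x\<close> to \<open>y - a\<close>
    produces the extra term \<open>x \<bullet> a\<close>, which the tilt in \<open>f\<close>
    cancels.\<close>
  define g where "g z = \<psi> (z - a) - (norm (z - a))\<^sup>2 / 2" for z
  have f_meas[measurable]: "f \<in> borel_measurable borel" unfolding f_def by measurable
  have g_meas[measurable]: "g \<in> borel_measurable borel" unfolding g_def by measurable
  have fg: "f x + g y \<le> - (x \<bullet> y)" for x y
  proof -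
    have "f x + g y \<le> (norm (x - (y - a)))\<^sup>2 / 2 - a \<bullet> x - (norm x)\<^sup>2 / 2 - (norm (y - a))\<^sup>2 / 2"
      using le[of x "y - a"] by (simp add: f_def g_def)
    also have "\<dots> = - (x \<bullet> y)"
      by (simp add: power2_norm_eq_inner inner_diff_left inner_diff_right inner_add_left inner_add_right
          inner_commute field_simps)
    finally show ?thesis .
  qed
  have exp_f: "exp (f x) = k * (gauss_density x * exp (\<phi> x - a \<bullet> x))" for x
    unfolding k_def f_def by (rule exp_minus_half_square)
  have "barycenter_zero (\<lambda>x. exp (f x))"
  proof -
    have int: "integrable lborel (\<lambda>x. gauss_density x *\<^sub>R (exp (\<phi> x - a \<bullet> x) *\<^sub>R x))"
      using int_\<phi>x unfolding std_gaussian_eq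
      by (subst (asm) integrable_density) (auto simp: less_imp_le[OF gauss_density_pos])
    have eq: "exp (f x) *\<^sub>R x = k *\<^sub>R (gauss_density x *\<^sub>R (exp (\<phi> x - a \<bullet> x) *\<^sub>R x))" for x
      by (simp add: exp_f mult.assoc)
    have int': "integrable lborel (\<lambda>x. exp (f x) *\<^sub>R x)"
      unfolding eq by (intro integrable_scaleR_right int)
    have "(\<integral>x. exp (f x) *\<^sub>R x \<partial>lborel) = k *\<^sub>R (\<integral>x. exp (\<phi> x - a \<bullet> x) *\<^sub>R x \<partial>std_gaussian)"
      unfolding eq integral_scaleR_right std_gaussian_eq
      by (subst integral_density) (auto simp: less_imp_le[OF gauss_density_pos])
    then have "(\<integral>x. exp (f x) *\<^sub>R x \<partial>lebesgue) = 0"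
      using a by (subst integral_completion) auto
    moreover have "integrable lborel (\<lambda>x. norm x * exp (f x))"
      using integrable_norm[OF int'] by (simp add: mult.commute)
    then have "integrable lebesgue (\<lambda>x. norm x * exp (f x))"
      by (subst integrable_completion) auto
    ultimately show ?thesis by (simp add: barycenter_zero_def)
  qed
  moreover have "f \<in> borel_measurable lebesgue" "g \<in> borel_measurable lebesgue"
    by (intro measurable_completion; simp)+
  ultimately have "(\<integral>\<^sup>+x. ennreal (exp (f x)) \<partial>lebesgue) * (\<integral>\<^sup>+x. ennreal (exp (g x)) \<partial>lebesgue)
      \<le> ennreal ((2 * pi) ^ DIM('a))"
    using santalo fg unfolding santalo_ineq_def by blast
  also have "(\<integral>\<^sup>+x. ennreal (exp (f x)) \<partial>lebesgue) = ennreal (k * F)"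
    unfolding nn_integral_completion f_def F_def k_def
    by (rule nn_integral_exp_gaussian_shape[OF _ int_\<phi>]) measurable
  also have "(\<integral>\<^sup>+x. ennreal (exp (g x)) \<partial>lebesgue) = ennreal (k * G)"
  proof -
    have "(\<integral>\<^sup>+x. ennreal (exp (g x)) \<partial>lebesgue) = (\<integral>\<^sup>+x. ennreal (exp (\<psi> x - (norm x)\<^sup>2 / 2)) \<partial>lborel)"
      unfolding nn_integral_completion g_def by (rule nn_integral_lborel_shift) measurable
    also have "\<dots> = ennreal (k * G)"
      unfolding G_def k_def by (rule nn_integral_exp_gaussian_shape[OF _ int_\<psi>]) measurable
    finally show ?thesis .
  qed
  finally have "ennreal (k * F) * ennreal (k * G) \<le> ennreal (k * k)" by (simp add: kk)
  moreover have "0 \<le> F" "0 \<le> G" by (simp_all add: F_def G_def)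
  ultimately have "(k * k) * (F * G) \<le> (k * k) * 1"
    using k by (simp add: ennreal_mult[symmetric] mult_ac)
  then have "F * G \<le> 1" using k by (subst (asm) mult_le_cancel_left_pos) auto
  then show thesis using int_\<phi> int_\<psi> by (intro that[of a]) (simp_all add: F_def G_def)
qed

proposition talagrand_if_santalo:
  fixes \<mu> \<nu> :: "'a::euclidean_space measure"
  assumes santalo: "santalo_ineq TYPE('a)"
    and \<mu>: "borel_prob \<mu>" "centered \<mu>" and \<nu>: "borel_prob \<nu>"
  shows "enn2ereal (W2_squared \<mu> \<nu>) \<le> 2 * rel_entropy std_gaussian \<mu> + 2 * rel_entropy std_gaussian \<nu>"
proof -
  interpret \<gamma>: finite_measure "std_gaussian :: 'a measure" by (rule finite_measure_std_gaussian)
  interpret M: prob_space \<mu> using \<mu> by (simp add: borel_prob_def)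
  interpret N: prob_space \<nu> using \<nu> by (simp add: borel_prob_def)
  have s\<mu>: "sets \<mu> = sets std_gaussian" and s\<nu>: "sets \<nu> = sets std_gaussian"
    using \<mu> \<nu> by (simp_all add: borel_prob_def)
  have [measurable_cong]: "sets \<mu> = sets borel" "sets \<nu> = sets borel"
    using s\<mu> s\<nu> by simp_all
  note cases_\<mu> = rel_entropy_finite_cases[OF \<gamma>.finite_measure_axioms s\<mu>]
  note cases_\<nu> = rel_entropy_finite_cases[OF \<gamma>.finite_measure_axioms s\<nu>]
  have "rel_entropy std_gaussian \<mu> \<noteq> - \<infinity>" by (rule cases_\<mu>) simp_all
  moreover have "rel_entropy std_gaussian \<nu> \<noteq> - \<infinity>" by (rule cases_\<nu>) simp_all
  ultimately have not_MInf: "rel_entropy std_gaussian \<mu> \<noteq> - \<infinity>" "rel_entropy std_gaussian \<nu> \<noteq> - \<infinity>"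
    by auto
  show ?thesis
  proof (cases "rel_entropy std_gaussian \<mu> = \<infinity> \<or> rel_entropy std_gaussian \<nu> = \<infinity>")
    \<comment> \<open>One infinite entropy makes the right side infinite because the other is not
      minus infinity.\<close>
    case True
    with not_MInf show ?thesis
      by (cases "rel_entropy std_gaussian \<mu>"; cases "rel_entropy std_gaussian \<nu>") auto
  next
    case False
    then have \<mu>_fin: "absolutely_continuous std_gaussian \<mu>"
        "integrable \<mu> (\<lambda>x. ln (enn2real (RN_deriv std_gaussian \<mu> x)))"
        "rel_entropy std_gaussian \<mu> = ereal (\<integral>x. ln (enn2real (RN_deriv std_gaussian \<mu> x)) \<partial>\<mu>)"
      and \<nu>_fin: "absolutely_continuous std_gaussian \<nu>"
        "integrable \<nu> (\<lambda>x. ln (enn2real (RN_deriv std_gaussian \<nu> x)))"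
        "rel_entropy std_gaussian \<nu> = ereal (\<integral>x. ln (enn2real (RN_deriv std_gaussian \<nu> x)) \<partial>\<nu>)"
      using cases_\<mu> cases_\<nu> by blast+
      define E where "E = (\<integral>x. ln (enn2real (RN_deriv std_gaussian \<mu> x)) \<partial>\<mu>)"
      define E' where "E' = (\<integral>x. ln (enn2real (RN_deriv std_gaussian \<nu> x)) \<partial>\<nu>)"
      have exp_sq: "integrable std_gaussian (\<lambda>x::'a. exp ((norm x)\<^sup>2 / 4))"
        by (rule integrable_std_gaussianI[where C = 1 and K = 0]) auto
      have "integrable \<mu> (\<lambda>x. 4 * ((norm x)\<^sup>2 / 4))"
        by (intro integrable_mult_right, rule integrable_if_exp_integrable[OF \<gamma>.finite_measure_axioms M.prob_space_axioms s\<mu>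
              \<mu>_fin(1,2) _ _ exp_sq]) auto
      then have mom: "integrable \<mu> (\<lambda>x. (norm x)\<^sup>2)" by simp
      have "integrable \<nu> (\<lambda>x. 4 * ((norm x)\<^sup>2 / 4))"
        by (intro integrable_mult_right, rule integrable_if_exp_integrable[OF \<gamma>.finite_measure_axioms N.prob_space_axioms s\<nu>
              \<nu>_fin(1,2) _ _ exp_sq]) auto
      then have mom': "integrable \<nu> (\<lambda>x. (norm x)\<^sup>2)" by simp
      have x_int: "integrable \<mu> (\<lambda>x. x)" and x_mean: "(\<integral>x. x \<partial>\<mu>) = 0"
        using \<mu>(2) unfolding centered_def by (auto intro: integrable_norm_cancel)
      have dual: "(\<integral>x. \<phi> x \<partial>\<mu>) + (\<integral>y. \<psi> y \<partial>\<nu>) \<le> E + E'"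
        if meas[measurable]: "\<phi> \<in> borel_measurable borel" "\<psi> \<in> borel_measurable borel"
          and bd: "bounded (range \<phi>)" "bounded (range \<psi>)"
          and le: "\<And>x y. \<phi> x + \<psi> y \<le> (norm (x - y))\<^sup>2 / 2" for \<phi> \<psi> :: "'a \<Rightarrow> real"
      proof -
        obtain a where a: "integrable std_gaussian (\<lambda>x. exp (\<phi> x - a \<bullet> x))"
            "integrable std_gaussian (\<lambda>x. exp (\<psi> x))"
            "(\<integral>x. exp (\<phi> x - a \<bullet> x) \<partial>std_gaussian) * (\<integral>x. exp (\<psi> x) \<partial>std_gaussian) \<le> 1"
          using santalo_dual_bound[OF santalo meas bd le] .
        obtain B where "\<And>x. \<bar>\<phi> x\<bar> \<le> B" using bd(1) by (auto simp: bounded_iff)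
        then have int_\<phi>: "integrable \<mu> \<phi>" by (intro M.integrable_const_bound) auto
        obtain B' where "\<And>x. \<bar>\<psi> x\<bar> \<le> B'" using bd(2) by (auto simp: bounded_iff)
        then have int_\<psi>: "integrable \<nu> \<psi>" by (intro N.integrable_const_bound) auto
        have int_tilt: "integrable \<mu> (\<lambda>x. \<phi> x - a \<bullet> x)" using int_\<phi> x_int by simp
        \<comment> \<open>Here the centering of \<mu> enters: the tilt has \<mu>-mean zero.\<close>
        have mean: "(\<integral>x. \<phi> x - a \<bullet> x \<partial>\<mu>) = (\<integral>x. \<phi> x \<partial>\<mu>)"
          using int_\<phi> x_int x_mean by simp
        have 1: "exp ((\<integral>x. \<phi> x \<partial>\<mu>) - E) \<le> (\<integral>x. exp (\<phi> x - a \<bullet> x) \<partial>std_gaussian)"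
          using gibbs_variational[OF \<gamma>.sigma_finite_measure_axioms M.prob_space_axioms s\<mu>
              \<mu>_fin(1,2) _ int_tilt a(1)] by (simp add: mean E_def)
        have 2: "exp ((\<integral>x. \<psi> x \<partial>\<nu>) - E') \<le> (\<integral>x. exp (\<psi> x) \<partial>std_gaussian)"
          using gibbs_variational[OF \<gamma>.sigma_finite_measure_axioms N.prob_space_axioms s\<nu>
              \<nu>_fin(1,2) _ int_\<psi> a(2)] by (simp add: E'_def)
        have "exp (((\<integral>x. \<phi> x \<partial>\<mu>) - E) + ((\<integral>x. \<psi> x \<partial>\<nu>) - E')) \<le> 1"
          unfolding exp_add by (rule order_trans[OF mult_mono[OF 1 2] a(3)]) simp_all
        then show ?thesis by simp
      qed
      have "W2_squared \<mu> \<nu> \<le> ennreal (2 * (E + E'))"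
        by (rule W2_squared_le_dual[OF \<mu>(1) \<nu> mom mom' dual])
      \<comment> \<open>Zero potentials are admissible. Nonnegativity guarantees that
        \<open>ennreal\<close> has not truncated the bound.\<close>
      moreover have "0 \<le> E + E'"
        using dual[of "\<lambda>_. 0" "\<lambda>_. 0"] by simp
      ultimately have "enn2ereal (W2_squared \<mu> \<nu>) \<le> ereal (2 * (E + E'))"
        by (simp add: less_eq_ennreal.rep_eq enn2ereal_ennreal)
      then show ?thesis using \<mu>_fin(3) \<nu>_fin(3) by (simp add: E_def E'_def)
  qed
qed

subsection \<open>From Talagrand to Santalo\<close>

text \<open>Integrate the constraint along an arbitrary coupling. \<open>P\<close> and
  \<open>Q\<close> allow exceptional null sets, as needed for Borel representatives; a null set of a
  marginal pulls back to a null set of the coupling.\<close>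

lemma W2_squared_ge_dual:
  fixes \<mu> \<nu> :: "'a::euclidean_space measure" and A B :: "'a \<Rightarrow> real"
  assumes int: "integrable \<mu> A" "integrable \<nu> B" and sets: "sets \<mu> = sets borel" "sets \<nu> = sets borel"
    and AE: "AE x in \<mu>. P x" "AE y in \<nu>. Q y"
    and le: "\<And>x y. P x \<Longrightarrow> Q y \<Longrightarrow> A x + B y \<le> (norm (x - y))\<^sup>2 / 2"
  shows "ennreal (2 * ((\<integral>x. A x \<partial>\<mu>) + (\<integral>y. B y \<partial>\<nu>))) \<le> W2_squared \<mu> \<nu>"
  unfolding W2_squared_def
proof (rule INF_greatest)
  fix \<pi> assume "\<pi> \<in> couplings \<mu> \<nu>"
  then have [measurable_cong]: "sets \<pi> = sets (borel \<Otimes>\<^sub>M borel)"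
    and marg: "distr \<pi> borel fst = \<mu>" "distr \<pi> borel snd = \<nu>"
    by (auto simp: couplings_def)
  have A_meas: "A \<in> borel_measurable borel"
    using borel_measurable_integrable[OF int(1)] measurable_cong_sets[OF sets(1) refl] by auto
  have B_meas: "B \<in> borel_measurable borel"
    using borel_measurable_integrable[OF int(2)] measurable_cong_sets[OF sets(2) refl] by auto
  have iA: "integrable \<pi> (\<lambda>z. A (fst z))"
    using int(1) A_meas unfolding marg(1)[symmetric] by (subst (asm) integrable_distr_eq) auto
  have iB: "integrable \<pi> (\<lambda>z. B (snd z))"
    using int(2) B_meas unfolding marg(2)[symmetric] by (subst (asm) integrable_distr_eq) auto
  have A_eq: "(\<integral>x. A x \<partial>\<mu>) = (\<integral>z. A (fst z) \<partial>\<pi>)"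
    unfolding marg(1)[symmetric] by (rule integral_distr) (use A_meas in auto)
  have B_eq: "(\<integral>x. B x \<partial>\<nu>) = (\<integral>z. B (snd z) \<partial>\<pi>)"
    unfolding marg(2)[symmetric] by (rule integral_distr) (use B_meas in auto)
  have "AE z in \<pi>. P (fst z)"
    by (rule AE_distrD[of fst \<pi> borel]) (use AE marg in auto)
  moreover have "AE z in \<pi>. Q (snd z)"
    by (rule AE_distrD[of snd \<pi> borel]) (use AE marg in auto)
  ultimately have AE_le: "AE z in \<pi>. 2 * (A (fst z) + B (snd z)) \<le> (norm (fst z - snd z))\<^sup>2"
    by eventually_elim (use le in force)
  define u where "u z = 2 * (A (fst z) + B (snd z))" for z
  have u: "integrable \<pi> u" unfolding u_def using iA iB by simp
  have "2 * ((\<integral>x. A x \<partial>\<mu>) + (\<integral>y. B y \<partial>\<nu>)) = (\<integral>z. u z \<partial>\<pi>)"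
    unfolding u_def using iA iB by (simp add: A_eq B_eq)
  \<comment> \<open>The cost is nonnegative, so it still dominates the positive part, for which the
    integral can be taken in \<open>ennreal\<close>.\<close>
  also have "\<dots> \<le> (\<integral>z. max 0 (u z) \<partial>\<pi>)"
    using u by (intro integral_mono) auto
  finally have "ennreal (2 * ((\<integral>x. A x \<partial>\<mu>) + (\<integral>y. B y \<partial>\<nu>))) \<le> ennreal (\<integral>z. max 0 (u z) \<partial>\<pi>)"
    by (rule ennreal_leI)
  also have "\<dots> = (\<integral>\<^sup>+z. ennreal (max 0 (u z)) \<partial>\<pi>)"
    using u by (intro nn_integral_eq_integral[symmetric]) auto
  also have "\<dots> \<le> (\<integral>\<^sup>+z. ennreal ((norm (fst z - snd z))\<^sup>2) \<partial>\<pi>)"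
    using AE_le by (intro nn_integral_mono_AE) (auto simp: u_def intro!: ennreal_leI elim!: eventually_mono)
  finally show "ennreal (2 * ((\<integral>x. A x \<partial>\<mu>) + (\<integral>y. B y \<partial>\<nu>)))
      \<le> (\<integral>\<^sup>+z. ennreal ((norm (fst z - snd z))\<^sup>2) \<partial>\<pi>)" .
qed

text \<open>Since \<open>g\<close> is finite at the points \<open>\<plusminus>R b\<close>, the constraint forces \<open>f\<close> to decay faster
  than any linear function; in particular every integral below is finite.\<close>

lemma dual_pair_decay:
  fixes f g :: "'a::euclidean_space \<Rightarrow> real"
  assumes fg: "\<And>x y. f x + g y \<le> - (x \<bullet> y)" and "0 \<le> K"
  obtains C where "\<And>x. f x \<le> C - K * norm x"
proof
  \<comment> \<open>Averaging the coordinatewise bounds over the basis divides the rate by the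
    dimension, and the 1-norm dominates the norm; rate \<open>K\<close> remains.\<close>
  define R where "R = K * DIM('a)"
  define C where "C = (\<Sum>b\<in>Basis. \<bar>g (R *\<^sub>R b)\<bar> + \<bar>g (- R *\<^sub>R b)\<bar>)"
  fix x :: 'a
  have "f x \<le> C - R * \<bar>x \<bullet> b\<bar>" if "b \<in> Basis" for b
  proof -
    have "\<bar>g (R *\<^sub>R b)\<bar> + \<bar>g (- R *\<^sub>R b)\<bar> \<le> C"
      unfolding C_def using that by (intro member_le_sum) auto
    then show ?thesis
      using fg[of x "R *\<^sub>R b"] fg[of x "- R *\<^sub>R b"] by (auto simp: abs_if split: if_splits)
  qed
  then have "(\<Sum>b\<in>(Basis::'a set). f x) \<le> (\<Sum>b\<in>Basis. C - R * \<bar>x \<bullet> b\<bar>)" by (rule sum_mono)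
  also have "\<dots> = DIM('a) * C - R * (\<Sum>b\<in>Basis. \<bar>x \<bullet> b\<bar>)"
    by (simp add: sum_subtractf sum_distrib_left)
  also have "\<dots> \<le> DIM('a) * C - R * norm x"
    using norm_le_l1[of x] \<open>0 \<le> K\<close> by (simp add: R_def mult_left_mono)
  finally have "DIM('a) * f x \<le> DIM('a) * (C - K * norm x)" by (simp add: R_def algebra_simps)
  then show "f x \<le> C - K * norm x" by simp
qed

text \<open>Rate 2 is chosen so that half of it can be spent: on \<open>exp (f x / 2)\<close> when
  bounding \<open>f x * exp (f x)\<close>, and on \<open>exp (norm x)\<close> as a bound for half
  the squared norm. The remaining rate 1 gives integrability.\<close>

lemma exp_density_prob:
  fixes f :: "'a::euclidean_space \<Rightarrow> real"
  assumes f[measurable]: "f \<in> borel_measurable borel"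
    and decay: "AE x in lborel. f x \<le> C - 2 * norm x"
  defines "Z \<equiv> \<integral>x. exp (f x) \<partial>lborel"
  defines "\<mu> \<equiv> density lborel (\<lambda>x. ennreal (exp (f x) / Z))"
  shows "0 < Z" "(\<integral>\<^sup>+x. ennreal (exp (f x)) \<partial>lborel) = ennreal Z" "borel_prob \<mu>"
    "integrable \<mu> (\<lambda>x. f x + (norm x)\<^sup>2 / 2)"
    "rel_entropy std_gaussian \<mu>
      = ereal ((\<integral>x. f x + (norm x)\<^sup>2 / 2 \<partial>\<mu>) - ln Z + DIM('a) / 2 * ln (2 * pi))"
proof -
  have dom: "integrable lborel u"
    if [measurable]: "u \<in> borel_measurable borel" and u: "AE x in lborel. \<bar>u x\<bar> \<le> D * exp (- 1 * norm x)"
    for u :: "'a \<Rightarrow> real" and D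
  proof (rule Bochner_Integration.integrable_bound)
    show "integrable lborel (\<lambda>x::'a. D * exp (- 1 * norm x))"
      by (intro integrable_mult_right integrable_exp_neg_norm) simp
    show "AE x in lborel. norm (u x) \<le> norm (D * exp (- 1 * norm x))"
      using u by eventually_elim auto
  qed simp
  have exp_int: "integrable lborel (\<lambda>x. exp (f x))"
  proof (rule dom[where D = "exp C"])
    show "AE x in lborel. \<bar>exp (f x)\<bar> \<le> exp C * exp (- 1 * norm x)"
      using decay
    proof eventually_elim
      case (elim x)
      then show ?case using norm_ge_zero[of x] by (simp add: exp_add[symmetric] del: norm_ge_zero)
    qed
  qed simp
  show Z_eq: "(\<integral>\<^sup>+x. ennreal (exp (f x)) \<partial>lborel) = ennreal Z"
    unfolding Z_def by (rule nn_integral_eq_integral[OF exp_int]) simp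
  have "0 \<le> Z" unfolding Z_def by simp
  moreover have "Z \<noteq> 0"
  proof
    assume "Z = 0"
    then have "AE x in lborel :: 'a measure. exp (f x) = 0"
      unfolding Z_def using exp_int by (subst (asm) integral_nonneg_eq_0_iff_AE) auto
    then have "AE x in lborel :: 'a measure. False" by simp
    then show False by (simp add: AE_iff_null null_sets_def emeasure_lborel_UNIV)
  qed
  ultimately show Z: "0 < Z" by simp
  have sets_\<mu>[measurable_cong]: "sets \<mu> = sets borel" by (simp add: \<mu>_def)
  have "emeasure \<mu> (space \<mu>) = (\<integral>\<^sup>+x. ennreal (1 / Z) * ennreal (exp (f x)) \<partial>lborel)"
    using Z by (simp add: \<mu>_def emeasure_density ennreal_mult[symmetric])
  also have "\<dots> = ennreal (1 / Z) * ennreal Z" by (simp add: nn_integral_cmult Z_eq)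
  also have "\<dots> = 1" using Z by (simp add: ennreal_mult[symmetric])
  finally have "prob_space \<mu>" by (rule prob_spaceI)
  then show "borel_prob \<mu>" by (simp add: borel_prob_def sets_\<mu>)
  have int_\<mu>: "integrable \<mu> u"
    if [measurable]: "u \<in> borel_measurable borel" and "integrable lborel (\<lambda>x. u x * exp (f x))" for u :: "'a \<Rightarrow> real"
  proof -
    have "integrable lborel (\<lambda>x. 1 / Z * (u x * exp (f x)))" by (intro integrable_mult_right that)
    then show ?thesis
      unfolding \<mu>_def using Z by (subst integrable_density) (auto simp: mult.commute)
  qed
  have "integrable \<mu> f"
  proof (rule int_\<mu>[OF f dom[where D = "exp (2 * C) + 2 * exp (C / 2)"]])
    show "AE x in lborel. \<bar>f x * exp (f x)\<bar> \<le> (exp (2 * C) + 2 * exp (C / 2)) * exp (- 1 * norm x)"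
      using decay
    proof eventually_elim
      case (elim x)
      \<comment> \<open>The first term handles positive values and the second negative ones; after
        multiplication by \<open>exp (f x)\<close> both exponents are positive multiples of
        \<open>f x\<close>, where the decay applies.\<close>
      have "\<bar>f x\<bar> \<le> exp (f x) + 2 * exp (- f x / 2)"
        using exp_ge_add_one_self[of "f x"] exp_ge_add_one_self[of "- f x / 2"]
          exp_gt_zero[of "f x"] exp_gt_zero[of "- f x / 2"] by linarith
      then have "\<bar>f x * exp (f x)\<bar> \<le> (exp (f x) + 2 * exp (- f x / 2)) * exp (f x)"
        by (simp add: abs_mult mult_right_mono)
      also have "\<dots> = exp (2 * f x) + 2 * exp (f x / 2)"
        by (simp add: distrib_right exp_add[symmetric])
      also have "\<dots> \<le> exp (2 * C - norm x) + 2 * exp (C / 2 - norm x)"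
        using elim norm_ge_zero[of x] by (intro add_mono mult_left_mono exp_le_cancel_iff[THEN iffD2]) linarith+
      also have "\<dots> = (exp (2 * C) + 2 * exp (C / 2)) * exp (- 1 * norm x)"
        by (simp add: distrib_right exp_add[symmetric])
      finally show ?case .
    qed
  qed simp
  moreover have "integrable \<mu> (\<lambda>x. (norm x)\<^sup>2 / 2)"
  proof (rule int_\<mu>[OF _ dom[where D = "exp C"]])
    show "AE x in lborel. \<bar>(norm x)\<^sup>2 / 2 * exp (f x)\<bar> \<le> exp C * exp (- 1 * norm x)"
      using decay
    proof eventually_elim
      case (elim x)
      have "(norm x)\<^sup>2 / 2 \<le> exp (norm x)"
        using exp_lower_Taylor_quadratic[of "norm x"] norm_ge_zero[of x] by linarith
      then have "(norm x)\<^sup>2 / 2 * exp (f x) \<le> exp (norm x) * exp (C - 2 * norm x)"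
        using elim by (intro mult_mono) auto
      also have "\<dots> = exp C * exp (- 1 * norm x)" by (simp add: exp_add[symmetric])
      finally show ?case by simp
    qed
  qed simp_all
  ultimately show A: "integrable \<mu> (\<lambda>x. f x + (norm x)\<^sup>2 / 2)" by simp
  \<comment> \<open>The logarithm of the density of \<open>\<mu>\<close> with respect to \<gamma>,
    that is \<open>f x - ln Z\<close> minus the logarithm of \<open>gauss_density x\<close>.\<close>
  define h where "h x = f x + (norm x)\<^sup>2 / 2 - ln Z + DIM('a) / 2 * ln (2 * pi)" for x
  interpret M: prob_space \<mu> by fact
  interpret \<gamma>: finite_measure "std_gaussian :: 'a measure" by (rule finite_measure_std_gaussian)
  have h_meas[measurable]: "h \<in> borel_measurable borel" unfolding h_def by measurable
  have gauss_h: "gauss_density x * exp (h x) = exp (f x) / Z" for x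
  proof -
    define D where "D = DIM('a) / 2 * ln (2 * pi)"
    have "(2 * pi) powr (- real DIM('a) / 2) = exp (- D)" by (simp add: powr_def D_def)
    moreover have "exp (h x) = exp (f x + (norm x)\<^sup>2 / 2) * exp D / Z"
      using Z by (simp add: h_def D_def exp_add exp_diff)
    ultimately have "gauss_density x * exp (h x)
        = exp (- D + - (norm x)\<^sup>2 / 2 + (f x + (norm x)\<^sup>2 / 2) + D) / Z"
      by (simp only: gauss_density_def exp_add) simp
    then show ?thesis by simp
  qed
  have \<mu>_h: "\<mu> = density std_gaussian (\<lambda>x. ennreal (exp (h x)))"
    unfolding std_gaussian_eq \<mu>_def
    by (subst density_density_eq)
      (auto simp: ennreal_mult[symmetric] gauss_h less_imp_le[OF gauss_density_pos])
  have int_h: "integrable \<mu> h" unfolding h_def using A by simp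
  have "rel_entropy std_gaussian \<mu> = ereal (\<integral>x. h x \<partial>\<mu>)"
    by (rule rel_entropy_density_exp[OF \<gamma>.sigma_finite_measure_axioms _ \<mu>_h int_h]) simp
  also have "(\<integral>x. h x \<partial>\<mu>) = (\<integral>x. f x + (norm x)\<^sup>2 / 2 \<partial>\<mu>) - ln Z + DIM('a) / 2 * ln (2 * pi)"
    unfolding h_def using A by (simp add: M.prob_space)
  finally show "rel_entropy std_gaussian \<mu>
      = ereal ((\<integral>x. f x + (norm x)\<^sup>2 / 2 \<partial>\<mu>) - ln Z + DIM('a) / 2 * ln (2 * pi))" .
qed

text \<open>The integrals \<open>A\<close> and \<open>B\<close> appear both as the dual value below
  the transport cost and inside the entropies above it. They cancel exactly and leave
  \<open>ln Zf + ln Zg \<le> DIM('a) * ln (2 * pi)\<close>.\<close>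

lemma santalo_pair_if_talagrand:
  fixes f g :: "'a::euclidean_space \<Rightarrow> real"
  assumes tal: "\<And>\<mu> \<nu> :: 'a measure. borel_prob \<mu> \<Longrightarrow> centered \<mu> \<Longrightarrow> borel_prob \<nu> \<Longrightarrow>
      enn2ereal (W2_squared \<mu> \<nu>) \<le> 2 * rel_entropy std_gaussian \<mu> + 2 * rel_entropy std_gaussian \<nu>"
    and meas: "f \<in> borel_measurable lebesgue" "g \<in> borel_measurable lebesgue"
    and fg: "\<And>x y. f x + g y \<le> - (x \<bullet> y)" and bary: "barycenter_zero (\<lambda>x. exp (f x))"
  shows "(\<integral>\<^sup>+x. ennreal (exp (f x)) \<partial>lebesgue) * (\<integral>\<^sup>+x. ennreal (exp (g x)) \<partial>lebesgue)
    \<le> ennreal ((2 * pi) ^ DIM('a))"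
proof -
  \<comment> \<open>Borel densities come from the representatives \<open>f'\<close>,
    \<open>g'\<close>, while decay and constraint are pointwise facts about \<open>f\<close>,
    \<open>g\<close> and transfer only almost everywhere.\<close>
  obtain f' where f'[measurable]: "f' \<in> borel_measurable borel" and ff': "AE x in lborel. f x = f' x"
    using completion_ex_borel_measurable_real[OF meas(1)] by auto
  obtain g' where g'[measurable]: "g' \<in> borel_measurable borel" and gg': "AE x in lborel. g x = g' x"
    using completion_ex_borel_measurable_real[OF meas(2)] by auto
  obtain C where C: "\<And>x. f x \<le> C - 2 * norm x"
    using dual_pair_decay[of f g 2] fg by auto
  obtain D where D: "\<And>x. g x \<le> D - 2 * norm x"
  proof (rule dual_pair_decay[of g f 2])
    show "g x + f y \<le> - (x \<bullet> y)" for x y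
      using fg[of y x] by (simp add: add.commute inner_commute)
  qed auto
  define Zf where "Zf = (\<integral>x. exp (f' x) \<partial>lborel)"
  define Zg where "Zg = (\<integral>x. exp (g' x) \<partial>lborel)"
  define \<mu> where "\<mu> = density lborel (\<lambda>x. ennreal (exp (f' x) / Zf))"
  define \<nu> where "\<nu> = density lborel (\<lambda>x. ennreal (exp (g' x) / Zg))"
  have decay_f: "AE x in lborel. f' x \<le> C - 2 * norm x"
    using ff' by eventually_elim (use C in metis)
  have decay_g: "AE x in lborel. g' x \<le> D - 2 * norm x"
    using gg' by eventually_elim (use D in metis)
  note \<mu> = exp_density_prob[OF f' decay_f, folded Zf_def, folded \<mu>_def]
  note \<nu> = exp_density_prob[OF g' decay_g, folded Zg_def, folded \<nu>_def]
  have sets_\<mu>: "sets \<mu> = sets borel" and sets_\<nu>: "sets \<nu> = sets borel"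
    by (simp_all add: \<mu>_def \<nu>_def)
  have ff'_leb: "AE x in lebesgue. f x = f' x" by (rule AE_completion[OF ff'])
  have f'_leb[measurable]: "f' \<in> borel_measurable lebesgue" by (intro measurable_completion) simp
  note meas(1)[measurable]
  have id_leb: "(\<lambda>x::'a. x) \<in> borel_measurable lebesgue" by (intro measurable_completion) simp
  have "centered \<mu>"
  proof -
    have "integrable lebesgue (\<lambda>x. norm x * exp (f' x)) \<longleftrightarrow> integrable lebesgue (\<lambda>x. norm x * exp (f x))"
    proof -
      note id_leb[measurable]
      show ?thesis by (intro integrable_cong_AE) (use ff'_leb in auto)
    qed
    then have "integrable lborel (\<lambda>x. norm x * exp (f' x))"
      using bary by (subst (asm) integrable_completion) (auto simp: barycenter_zero_def)
    then have "integrable lborel (\<lambda>x. 1 / Zf * (norm x * exp (f' x)))" by (rule integrable_mult_right)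
    then have 1: "integrable \<mu> norm"
      unfolding \<mu>_def using \<mu>(1) by (subst integrable_density) (auto simp: mult.commute)
    have "(\<integral>x. exp (f' x) *\<^sub>R x \<partial>lborel) = (\<integral>x. exp (f' x) *\<^sub>R x \<partial>lebesgue)"
      by (rule integral_completion[symmetric]) measurable
    also have "\<dots> = (\<integral>x. exp (f x) *\<^sub>R x \<partial>lebesgue)"
    proof -
      note id_leb[measurable]
      show ?thesis by (intro integral_cong_AE) (use ff'_leb in auto)
    qed
    also have "\<dots> = 0" using bary by (simp add: barycenter_zero_def)
    finally have 0: "(\<integral>x. exp (f' x) *\<^sub>R x \<partial>lborel) = 0" .
    have "(\<integral>x. x \<partial>\<mu>) = (\<integral>x. (1 / Zf) *\<^sub>R (exp (f' x) *\<^sub>R x) \<partial>lborel)"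
      unfolding \<mu>_def using \<mu>(1) by (subst integral_density) auto
    also have "\<dots> = 0" unfolding integral_scaleR_right 0 by simp
    finally show ?thesis using 1 by (simp add: centered_def)
  qed
  define A where "A = (\<integral>x. f' x + (norm x)\<^sup>2 / 2 \<partial>\<mu>)"
  define B where "B = (\<integral>x. g' x + (norm x)\<^sup>2 / 2 \<partial>\<nu>)"
  have AE_\<mu>: "AE x in \<mu>. f x = f' x"
    unfolding \<mu>_def using ff' by (subst AE_density) (auto elim: eventually_mono)
  have AE_\<nu>: "AE x in \<nu>. g x = g' x"
    unfolding \<nu>_def using gg' by (subst AE_density) (auto elim: eventually_mono)
  have "ennreal (2 * (A + B)) \<le> W2_squared \<mu> \<nu>"
    unfolding A_def B_def
  proof (rule W2_squared_ge_dual[OF \<mu>(4) \<nu>(4) sets_\<mu> sets_\<nu> AE_\<mu> AE_\<nu>])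
    fix x y assume "f x = f' x" "g y = g' y"
    then show "f' x + (norm x)\<^sup>2 / 2 + (g' y + (norm y)\<^sup>2 / 2) \<le> (norm (x - y))\<^sup>2 / 2"
      using fg[of x y]
      by (simp add: power2_norm_eq_inner inner_diff_left inner_diff_right inner_commute field_simps)
  qed
  then have "enn2ereal (ennreal (2 * (A + B))) \<le> enn2ereal (W2_squared \<mu> \<nu>)"
    by (simp add: less_eq_ennreal.rep_eq)
  \<comment> \<open>\<open>A + B\<close> may be negative, where \<open>ennreal\<close> returns 0;
    that only increases the right side.\<close>
  moreover have "ereal (2 * (A + B)) \<le> enn2ereal (ennreal (2 * (A + B)))"
    by (cases "0 \<le> 2 * (A + B)") (simp_all add: enn2ereal_ennreal ennreal_neg zero_ennreal.rep_eq)
  ultimately have "ereal (2 * (A + B)) \<le> 2 * rel_entropy std_gaussian \<mu> + 2 * rel_entropy std_gaussian \<nu>"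
    using tal[OF \<mu>(3) \<open>centered \<mu>\<close> \<nu>(3)] by (meson order_trans)
  then have "ereal (2 * (A + B)) \<le> ereal (2 * (A - ln Zf + DIM('a) / 2 * ln (2 * pi))
      + 2 * (B - ln Zg + DIM('a) / 2 * ln (2 * pi)))"
    by (simp add: \<mu>(5) \<nu>(5) A_def B_def)
  then have "ln Zf + ln Zg \<le> DIM('a) * ln (2 * pi)" by (simp add: field_simps)
  then have "ln (Zf * Zg) \<le> ln ((2 * pi) ^ DIM('a))"
    using \<mu>(1) \<nu>(1) by (simp add: ln_mult ln_realpow distrib_left)
  then have "Zf * Zg \<le> (2 * pi) ^ DIM('a)"
    using \<mu>(1) \<nu>(1) by (subst (asm) ln_le_cancel_iff) auto
  moreover have "(\<integral>\<^sup>+x. ennreal (exp (f x)) \<partial>lebesgue) = ennreal Zf"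
    unfolding nn_integral_completion \<mu>(2)[symmetric]
    by (intro nn_integral_cong_AE) (use ff' in auto)
  moreover have "(\<integral>\<^sup>+x. ennreal (exp (g x)) \<partial>lebesgue) = ennreal Zg"
    unfolding nn_integral_completion \<nu>(2)[symmetric]
    by (intro nn_integral_cong_AE) (use gg' in auto)
  ultimately show ?thesis
    using \<mu>(1) \<nu>(1) by (simp add: ennreal_mult[symmetric] ennreal_leI)
qed

theorem proposition1p3:
  shows
  "(\<forall>\<mu> \<nu> :: 'a::euclidean_space measure.
      borel_prob \<mu> \<and> centered \<mu> \<and> borel_prob \<nu> \<longrightarrow>
      enn2ereal (W2_squared \<mu> \<nu>)
        \<le> 2 * rel_entropy std_gaussian \<mu> + 2 * rel_entropy std_gaussian \<nu>)
   \<longleftrightarrow>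
   (\<forall>f g :: 'a \<Rightarrow> real.
      f \<in> borel_measurable lebesgue \<and> g \<in> borel_measurable lebesgue \<and>
      (\<forall>x y. f x + g y \<le> - (x \<bullet> y)) \<and>
      (barycenter_zero (\<lambda>x. exp (f x)) \<or> barycenter_zero (\<lambda>x. exp (g x))) \<longrightarrow>
      (\<integral>\<^sup>+x. ennreal (exp (f x)) \<partial>lebesgue) * (\<integral>\<^sup>+x. ennreal (exp (g x)) \<partial>lebesgue)
        \<le> ennreal ((2 * pi) ^ DIM('a)))"
  (is "?tal \<longleftrightarrow> ?santalo")
proof
  assume tal: ?tal
  show ?santalo
  proof (intro allI impI, elim conjE disjE)
    fix f g :: "'a \<Rightarrow> real"
    assume meas: "f \<in> borel_measurable lebesgue" "g \<in> borel_measurable lebesgue"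
      and fg: "\<forall>x y. f x + g y \<le> - (x \<bullet> y)"
    {
      assume "barycenter_zero (\<lambda>x. exp (f x))"
      then show "(\<integral>\<^sup>+x. ennreal (exp (f x)) \<partial>lebesgue) * (\<integral>\<^sup>+x. ennreal (exp (g x)) \<partial>lebesgue)
        \<le> ennreal ((2 * pi) ^ DIM('a))"
        using tal meas fg by (intro santalo_pair_if_talagrand) blast+
    next
      \<comment> \<open>Constraint and product are symmetric in the two functions, so
        \<open>g\<close> can take the role of the centered one.\<close>
      assume "barycenter_zero (\<lambda>x. exp (g x))"
      moreover have "g x + f y \<le> - (x \<bullet> y)" for x y
        using fg[rule_format, of y x] by (simp add: add.commute inner_commute)
      ultimately show "(\<integral>\<^sup>+x. ennreal (exp (f x)) \<partial>lebesgue) * (\<integral>\<^sup>+x. ennreal (exp (g x)) \<partial>lebesgue)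
        \<le> ennreal ((2 * pi) ^ DIM('a))"
        using tal meas by (subst mult.commute, intro santalo_pair_if_talagrand) blast+
    }
  qed
next
  assume ?santalo
  then have "santalo_ineq TYPE('a)" unfolding santalo_ineq_def .
  then show ?tal using talagrand_if_santalo by blast
qed

end
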